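(* For $\rho,\sigma\in\mathcal{D}(\mathbb{C}^d)$, $O(d^2/\epsilon^2)$ copies are sufficient to distinguish via independent measurements, with probability of success at least $\frac23$, the case $\rho=\sigma$ from the case $\|\rho-\sigma\|_1>\epsilon$. That is, there is an absolute constant $K$ such that for every $d\ge1$ and $\epsilon\in(0,1]$ there is a procedure which uses independent measurements on at most $Kd^2/\epsilon^2$ copies of each of two unknown states $\rho,\sigma\in\mathcal{D}(\mathbb{C}^d)$ and outputs "Yes" with probability at least $\frac23$ if $\rho=\sigma$, and "No" with probability at least $\frac23$ if $\|\rho-\sigma\|_1>\epsilon$.
   Context: $\mathcal{D}(\mathbb{C}^d)$ is the set of density operators on $\mathbb{C}^d$. $\|A\|_1=\operatorname{Tr}\sqrt{A^\dagger A}$. Independent measurements: each copy of each state is measured separately by a POVM on $\mathbb{C}^d$, the POVMs being fixed in advance (non-adaptive), i.e. the overall POVM is a tensor product of POVMs acting on single copies; outcomes are then processed classically. *)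

theory Defs
  imports Complex_Main "Jordan_Normal_Form.Schur_Decomposition"
begin

definition trace :: "complex mat \<Rightarrow> complex" where
  "trace A = (\<Sum>i<dim_row A. A $$ (i, i))"

text \<open>Here \<open>\<le>\<close> on complex numbers is the order of \<open>HOL-Library.Complex_Order\<close>: the inner product
  is required to be real and nonnegative.\<close>

definition psd :: "nat \<Rightarrow> complex mat \<Rightarrow> bool" where
  "psd d A \<longleftrightarrow> A \<in> carrier_mat d d \<and> mat_adjoint A = A \<and>
     (\<forall>v\<in>carrier_vec d. 0 \<le> (A *\<^sub>v v) \<bullet>c v)"

text \<open>\<open>density_operators d\<close> is $\mathcal{D}(\mathbb{C}^d)$.\<close>

definition density_operators :: "nat \<Rightarrow> complex mat set" where
  "density_operators d = {\<rho>. psd d \<rho> \<and> trace \<rho> = 1}"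

text \<open>The positive semidefinite square root is unique, so the description below is well defined
  for positive semidefinite arguments, the only ones it is used for.\<close>

definition psd_sqrt :: "complex mat \<Rightarrow> complex mat" where
  "psd_sqrt A = (THE B. psd (dim_row A) B \<and> B * B = A)"

definition trace_norm :: "complex mat \<Rightarrow> real" where
  "trace_norm A = Re (trace (psd_sqrt (mat_adjoint A * A)))"

text \<open>Kronecker product: the matrix of the tensor product operator in the lexicographically
  ordered product basis.\<close>

definition kron :: "complex mat \<Rightarrow> complex mat \<Rightarrow> complex mat" where
  "kron A B = mat (dim_row A * dim_row B) (dim_col A * dim_col B)
     (\<lambda>(i, j). A $$ (i div dim_row B, j div dim_col B) * B $$ (i mod dim_row B, j mod dim_col B))"

definition tensor :: "complex mat list \<Rightarrow> complex mat" where
  "tensor As = foldr kron As (1\<^sub>m 1)"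

text \<open>A POVM with finitely many outcomes is given by the list of its effects; its outcomes are the
  positions in the list, so that equal effects may still carry different outcomes.\<close>

definition povm :: "nat \<Rightarrow> complex mat list \<Rightarrow> bool" where
  "povm d M \<longleftrightarrow> (\<forall>E\<in>set M. psd d E) \<and> foldr (+) M (0\<^sub>m d d) = 1\<^sub>m d"

text \<open>The tensor product of the POVMs in \<open>Ms\<close>: its outcomes are the lists consisting of one outcome
  of each factor, and the effect of such a list is the tensor product of the corresponding
  effects.\<close>

definition product_outcomes :: "complex mat list list \<Rightarrow> nat list set" where
  "product_outcomes Ms = {xs. list_all2 (\<lambda>M x. x < length M) Ms xs}"

definition product_effect :: "complex mat list list \<Rightarrow> nat list \<Rightarrow> complex mat" where
  "product_effect Ms xs = tensor (map2 (!) Ms xs)"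

text \<open>Born rule.\<close>

definition born :: "complex mat \<Rightarrow> complex mat \<Rightarrow> real" where
  "born \<rho> E = Re (trace (E * \<rho>))"

datatype verdict = Yes | No

text \<open>Independent measurements: the \<open>i\<close>-th copy of \<open>\<rho>\<close> is measured by the \<open>i\<close>-th POVM of \<open>Ms\<close> and the
  \<open>j\<close>-th copy of \<open>\<sigma>\<close> by the \<open>j\<close>-th POVM of \<open>Ns\<close>; the classical function \<open>f\<close> maps the list of all
  outcomes to a verdict. \<open>verdict_prob\<close> is the probability of the verdict \<open>b\<close> when the joint state is
  $\rho^{\otimes n}\otimes\sigma^{\otimes m}$, where \<open>n\<close> and \<open>m\<close> are the lengths of \<open>Ms\<close> and \<open>Ns\<close>.\<close>

definition verdict_prob ::
  "complex mat list list \<Rightarrow> complex mat list list \<Rightarrow> (nat list \<Rightarrow> verdict) \<Rightarrow>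
   complex mat \<Rightarrow> complex mat \<Rightarrow> verdict \<Rightarrow> real" where
  "verdict_prob Ms Ns f \<rho> \<sigma> b =
     (\<Sum>xs | xs \<in> product_outcomes (Ms @ Ns) \<and> f xs = b.
        born (tensor (replicate (length Ms) \<rho> @ replicate (length Ns) \<sigma>))
             (product_effect (Ms @ Ns) xs))"

end

theory Submission
  imports Defs "Jordan_Normal_Form.Spectral_Radius"
    "HOL-Computational_Algebra.Primes" "HOL-Real_Asymp.Real_Asymp"
begin

text \<open>
  Measure every copy with the same POVM with effects \<open>|u\<^sub>x\<rangle>\<langle>u\<^sub>x|\<close>, turning \<open>\<rho>\<close> and \<open>\<sigma>\<close> into
  distributions \<open>P\<close> and \<open>Q\<close>, and test \<open>P = Q\<close> in the \<open>l\<^sub>2\<close> norm. Let \<open>p\<close> be an odd prime with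
  \<open>d \<le> p = O(d)\<close>. The vectors \<open>u\<^sub>x\<close> are the \<open>p\<^sup>2\<close> characters of \<open>(\<int>/p)\<^sup>2\<close> restricted to the parabola
  \<open>{(i\<^sup>2, i) | i < d}\<close>, together with the standard basis with small weight. As differences of
  distinct points of the parabola are distinct, Parseval's identity gives
  \<open>\<parallel>P - Q\<parallel>\<^sub>2\<^sup>2 \<ge> \<parallel>\<rho> - \<sigma>\<parallel>\<^sub>2\<^sup>2 / (4 p\<^sup>2) \<ge> \<parallel>\<rho> - \<sigma>\<parallel>\<^sub>1\<^sup>2 / (4 d p\<^sup>2)\<close> and \<open>\<parallel>P\<parallel>\<^sub>2\<^sup>2, \<parallel>Q\<parallel>\<^sub>2\<^sup>2 \<le> 2 / p\<^sup>2\<close>. A statistic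
  counting collisions separates \<open>P = Q\<close> from \<open>\<parallel>P - Q\<parallel>\<^sub>2\<^sup>2 \<ge> \<eta>\<close> with \<open>O((\<parallel>P\<parallel>\<^sub>2 + \<parallel>Q\<parallel>\<^sub>2) / \<eta>)\<close> samples by
  Chebyshev's inequality, and with \<open>\<eta> = \<epsilon>\<^sup>2 / (4 d p\<^sup>2)\<close> this is \<open>O(d p / \<epsilon>\<^sup>2) = O(d\<^sup>2 / \<epsilon>\<^sup>2)\<close>.
\<close>

section \<open>A prime between d and O(d)\<close>

text \<open>The parabola characters alone cannot work: all diagonal entries of a matrix sit at the
  single difference 0, so these outcomes see the diagonal only through the trace, which cancels in
  \<open>\<rho> - \<sigma>\<close>. The standard basis is there to make the diagonal visible again.
  Primality serves the Sidon property, whose proof cancels factors modulo p. Since p enters the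
  sample bound d p / eps^2 as a factor, it must be linear in d, but any absolute constant will do; a
  Chebyshev-type estimate, comparing a lower and an upper bound for \<open>Lcm {1..N}\<close>, is
  therefore strong enough.\<close>

lemma four_power_le_Lcm:
  fixes m :: nat
  shows "4 ^ m \<le> Lcm {1..2 * m + 1}"
proof -
  define L where "L = Lcm {1..2 * m + 1}"
  \<comment> \<open>Nair's argument: \<open>F\<close> is the primitive of (x (1 - x))^m that
    vanishes at 0, expanded term by term. Its denominators m + k + 1 are at most 2 m + 1, so
    \<open>L * F 1\<close> is an integer, while \<open>F 1\<close> is positive and at most
    4^(-m).\<close>
  define F :: "real \<Rightarrow> real" where
    "F x = (\<Sum>k\<le>m. (-1) ^ k * real (m choose k) * (x ^ (m + k + 1) / real (m + k + 1)))" for x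
  have "(F has_real_derivative (x * (1 - x)) ^ m) (at x)" for x
  proof -
    have "(F has_real_derivative (\<Sum>k\<le>m. (-1) ^ k * real (m choose k) * x ^ (m + k))) (at x)"
      unfolding F_def
    proof (rule DERIV_sum)
      fix k
      have "((\<lambda>x. x ^ Suc (m + k) / real (Suc (m + k))) has_real_derivative
          real (Suc (m + k)) * x ^ (m + k) / real (Suc (m + k))) (at x)"
        using DERIV_cdivide[OF DERIV_pow[of "Suc (m + k)" x UNIV], of "real (Suc (m + k))"] by simp
      then have "((\<lambda>x. x ^ Suc (m + k) / real (Suc (m + k))) has_real_derivative x ^ (m + k)) (at x)"
        by (simp del: of_nat_Suc)
      then show "((\<lambda>x. (-1) ^ k * real (m choose k) * (x ^ (m + k + 1) / real (m + k + 1)))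
          has_real_derivative (-1) ^ k * real (m choose k) * x ^ (m + k)) (at x)"
        by (intro DERIV_cmult) simp
    qed
    moreover have "(\<Sum>k\<le>m. (-1) ^ k * real (m choose k) * x ^ (m + k)) = (x * (1 - x)) ^ m"
    proof -
      have "(1 - x) ^ m = (\<Sum>k\<le>m. real (m choose k) * (- x) ^ k * 1 ^ (m - k))"
        using binomial_ring[of "- x" 1 m] by simp
      then show ?thesis
        by (simp add: power_mult_distrib sum_distrib_left power_add power_minus[of x] mult_ac)
    qed
    ultimately show ?thesis by simp
  qed
  \<comment> \<open>The mean value theorem replaces integration: \<open>F 1\<close> is a value of
    the integrand strictly inside the unit interval, which gives both its sign and its size.\<close>
  then obtain z where z: "0 < z" "z < 1" "F 1 - F 0 = (1 - 0) * (z * (1 - z)) ^ m"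
    using MVT2[of 0 1 F "\<lambda>x. (x * (1 - x)) ^ m"] by auto
  have F0: "F 0 = 0" by (simp add: F_def)
  have "z * (1 - z) \<le> 1 / 4"
    using zero_le_power2[of "z - 1 / 2"] by (simp add: power2_eq_square algebra_simps)
  then have up: "F 1 \<le> (1 / 4) ^ m"
    using z F0 by (simp add: power_mono)
  have pos: "F 1 > 0" using z F0 by simp
  have "real L * F 1 \<in> \<int>"
  proof -
    have "real L * ((-1) ^ k * real (m choose k) * (1 ^ (m + k + 1) / real (m + k + 1))) \<in> \<int>"
      if "k \<le> m" for k
    proof -
      have "m + k + 1 dvd L" using that by (auto simp: L_def intro!: dvd_Lcm)
      then obtain c where "L = (m + k + 1) * c" by blast
      then have "real L * (1 / real (m + k + 1)) = real c"
        by (simp only: of_nat_mult) simp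
      then have "real L * ((-1) ^ k * real (m choose k) * (1 ^ (m + k + 1) / real (m + k + 1)))
        = (-1) ^ k * real (m choose k) * real c"
        by (metis mult.left_commute power_one)
      also have "\<dots> \<in> \<int>" by auto
      finally show ?thesis .
    qed
    then show ?thesis by (auto simp: F_def sum_distrib_left intro!: Ints_sum)
  qed
  moreover have Lpos: "L > 0" by (auto simp: L_def Lcm_0_iff_nat intro!: Nat.gr0I)
  ultimately have "1 \<le> real L * F 1"
    using pos by (metis Ints_nonzero_abs_ge1 abs_of_pos mult_pos_pos of_nat_0_less_iff order_less_irrefl)
  also have "\<dots> \<le> real L * (1 / 4) ^ m" using up by (simp add: mult_left_mono)
  finally have "4 ^ m \<le> real L" by (simp add: power_one_over field_simps)
  then show ?thesis unfolding L_def by (metis of_nat_le_iff of_nat_numeral of_nat_power)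
qed

lemma prod_dvd_of_primes:
  fixes S :: "nat set"
  assumes "\<And>p. p \<in> S \<Longrightarrow> p dvd n" "finite S" "\<And>p. p \<in> S \<Longrightarrow> prime p"
  shows "\<Prod>S dvd n"
  using assms(2,1,3)
proof (induction S)
  case (insert p S)
  have "coprime p (\<Prod>S)"
    using insert.hyps insert.prems by (intro prod_coprime_right primes_coprime) auto
  then show ?case using insert by (simp add: divides_mult)
qed simp

text \<open>Restricting to powers of two makes doubling the whole induction step: every prime in (k,
  2 k] divides \<open>2 * k choose k\<close>, which is at most 4^k, and the exponents 2^i and 2^i
  add up.\<close>

lemma prod_primes_le_four_power:
  "(\<Prod>p | prime p \<and> p \<le> (2::nat) ^ i. p) \<le> 4 ^ 2 ^ i"
proof (induction i)
  case 0
  have "\<not> (prime p \<and> p \<le> 2 ^ 0)" for p :: nat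
    using prime_ge_2_nat[of p] by auto
  then have "{p. prime p \<and> p \<le> (2::nat) ^ 0} = {}" by blast
  then show ?case by (metis prod.empty one_le_numeral one_le_power)
next
  case (Suc i)
  define k :: nat where "k = 2 ^ i"
  define S where "S = {p. prime p \<and> k < p \<and> p \<le> 2 * k}"
  have fin: "finite {p. prime p \<and> p \<le> k}" "finite S"
    unfolding S_def by (auto intro: finite_subset[of _ "{..2 * k}"])
  have "{p. prime p \<and> p \<le> 2 ^ Suc i} = {p. prime p \<and> p \<le> k} \<union> S"
    by (auto simp: S_def k_def)
  then have eq: "(\<Prod>p | prime p \<and> p \<le> 2 ^ Suc i. p) = (\<Prod>p | prime p \<and> p \<le> k. p) * \<Prod>S"
    using fin by (simp add: prod.union_disjoint S_def disjoint_iff)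
  have "\<Prod>S dvd (2 * k choose k)"
  proof -
    have "p dvd (2 * k choose k)" if "p \<in> S" for p
    proof -
      have p: "prime p" "k < p" "p \<le> 2 * k" using that by (auto simp: S_def)
      have "p dvd fact k * fact k * (2 * k choose k)"
        using binomial_fact_lemma[of k "2 * k"] p by (simp add: prime_dvd_fact_iff mult_2)
      then show ?thesis
        using p by (auto simp: prime_dvd_mult_iff prime_dvd_fact_iff)
    qed
    then show ?thesis
      using fin(2)
    proof (rule prod_dvd_of_primes)
      show "prime p" if "p \<in> S" for p using that by (simp add: S_def)
    qed
  qed
  then have "\<Prod>S \<le> 2 * k choose k" by (rule dvd_imp_le) simp
  also have "\<dots> \<le> 2 ^ (2 * k)" by (rule binomial_le_pow2)
  also have "\<dots> = 4 ^ k" by (simp add: power_mult)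
  finally have "\<Prod>S \<le> 4 ^ 2 ^ i" unfolding k_def .
  then have "(\<Prod>p | prime p \<and> p \<le> k. p) * \<Prod>S \<le> 4 ^ 2 ^ i * 4 ^ 2 ^ i"
    using Suc.IH unfolding k_def by (intro mult_mono) auto
  also have "\<dots> = 4 ^ 2 ^ Suc i" by (simp add: mult_2 power_add)
  finally show ?case unfolding eq .
qed

text \<open>Every prime power in the least common multiple is at most N, and a prime with p^2 > N
  occurs with exponent at most 1. Only the at most sqrt N primes with p^2 \<le> N can exceed their
  contribution to the primorial, and each of them is charged a generous extra factor N.\<close>

lemma Lcm_le_prod_primes:
  fixes N :: nat
  assumes "N > 0"
  shows "real (Lcm {1..N}) \<le> real N powr sqrt (real N) * (\<Prod>p | prime p \<and> p \<le> N. real p)"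
proof -
  define P where "P = {p. prime p \<and> p \<le> N}"
  define e where "e p = (GREATEST k. p ^ k \<le> N)" for p
  have fin: "finite P" unfolding P_def by (auto intro: finite_subset[of _ "{..N}"])
  \<comment> \<open>\<open>GREATEST\<close> is meaningful only for bounded exponents; here k < 2^k
    \<le> p^k \<le> N.\<close>
  have bd: "k \<le> N" if "p \<in> P" "p ^ k \<le> N" for p k
  proof -
    have "k < 2 ^ k" by simp
    also have "(2::nat) ^ k \<le> p ^ k"
      using that prime_ge_2_nat by (intro power_mono) (auto simp: P_def)
    finally show ?thesis using that by simp
  qed
  have e1: "p ^ e p \<le> N" if "p \<in> P" for p
    unfolding e_def by (rule GreatestI_nat[where k = 0 and b = N]) (use assms bd that in auto)
  have e2: "k \<le> e p" if "p \<in> P" "p ^ k \<le> N" for p k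
    unfolding e_def by (rule Greatest_le_nat[where b = N]) (use bd that in auto)
  have "Lcm {1..N} dvd (\<Prod>p\<in>P. p ^ e p)"
  proof (rule Lcm_least)
    fix n assume n: "n \<in> {1..N}"
    have "n = (\<Prod>p\<in>prime_factors n. p ^ multiplicity p n)"
      using n by (intro prime_factorization_nat) auto
    also have "\<dots> = (\<Prod>p\<in>P. p ^ multiplicity p n)"
    proof (rule prod.mono_neutral_left[OF fin])
      show "prime_factors n \<subseteq> P"
      proof
        fix p assume "p \<in> prime_factors n"
        then have "prime p" "p dvd n" by auto
        then show "p \<in> P" using n dvd_imp_le[of p n] by (auto simp: P_def)
      qed
      show "\<forall>p\<in>P - prime_factors n. p ^ multiplicity p n = 1"
        using n by (auto simp: P_def in_prime_factors_iff not_dvd_imp_multiplicity_0)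
    qed
    also have "\<dots> dvd (\<Prod>p\<in>P. p ^ e p)"
    proof (rule prod_dvd_prod)
      fix p assume p: "p \<in> P"
      have "p ^ multiplicity p n \<le> n"
        using n by (intro dvd_imp_le multiplicity_dvd) auto
      then show "p ^ multiplicity p n dvd p ^ e p"
        using n by (intro le_imp_power_dvd e2[OF p]) auto
    qed
    finally show "n dvd (\<Prod>p\<in>P. p ^ e p)" .
  qed
  moreover have "(\<Prod>p\<in>P. p ^ e p) > 0"
    by (intro prod_pos) (auto simp: P_def prime_gt_0_nat)
  ultimately have "Lcm {1..N} \<le> (\<Prod>p\<in>P. p ^ e p)" by (rule dvd_imp_le)
  then have "real (Lcm {1..N}) \<le> real (\<Prod>p\<in>P. p ^ e p)"
    by (rule of_nat_mono)
  also have "\<dots> = (\<Prod>p\<in>P. real (p ^ e p))" by simp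
  also have "\<dots> \<le> (\<Prod>p\<in>P. (if p\<^sup>2 \<le> N then real N else 1) * real p)"
  proof (rule prod_mono, rule conjI)
    fix p assume p: "p \<in> P"
    have p1: "p \<ge> 1" using p using prime_ge_1_nat by (auto simp: P_def)
    show "real (p ^ e p) \<le> (if p\<^sup>2 \<le> N then real N else 1) * real p"
    proof (cases "p\<^sup>2 \<le> N")
      case True
      have "real (p ^ e p) \<le> real N * 1" using e1[OF p] by (simp add: of_nat_le_iff del: of_nat_power)
      also have "\<dots> \<le> real N * real p" using p1 by (intro mult_left_mono) auto
      finally show ?thesis using True by simp
    next
      case False
      have "e p \<le> 1"
      proof (rule ccontr)
        assume "\<not> e p \<le> 1"
        then have "p\<^sup>2 \<le> p ^ e p" using p1 by (intro power_increasing) auto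
        then show False using False e1[OF p] by simp
      qed
      then have "p ^ e p \<le> p ^ 1" using p1 by (intro power_increasing) auto
      then show ?thesis using False by (simp del: of_nat_power)
    qed
  qed simp
  also have "\<dots> = (\<Prod>p\<in>P. if p\<^sup>2 \<le> N then real N else 1) * (\<Prod>p\<in>P. real p)"
    by (rule prod.distrib)
  also have "(\<Prod>p\<in>P. if p\<^sup>2 \<le> N then real N else 1) = real N ^ card {p\<in>P. p\<^sup>2 \<le> N}"
    using fin by (simp add: prod.If_cases Int_def)
  also have "\<dots> \<le> real N powr sqrt (real N)"
  proof -
    have "{p\<in>P. p\<^sup>2 \<le> N} \<subseteq> {1..nat \<lfloor>sqrt (real N)\<rfloor>}"
      by (auto simp: P_def prime_ge_1_nat le_nat_floor real_le_rsqrt Suc_le_eq prime_gt_0_nat simp flip: of_nat_power)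
    then have "card {p\<in>P. p\<^sup>2 \<le> N} \<le> nat \<lfloor>sqrt (real N)\<rfloor>"
      using card_mono[of "{1..nat \<lfloor>sqrt (real N)\<rfloor>}"] by force
    then have "real (card {p\<in>P. p\<^sup>2 \<le> N}) \<le> real (nat \<lfloor>sqrt (real N)\<rfloor>)"
      by (rule of_nat_mono)
    also have "\<dots> \<le> sqrt (real N)" by (simp add: of_nat_floor)
    finally have "real (card {p\<in>P. p\<^sup>2 \<le> N}) \<le> sqrt (real N)" .
    then show ?thesis using assms
      by (subst powr_realpow[symmetric]) (auto intro!: powr_mono)
  qed
  finally show ?thesis unfolding P_def by (simp add: mult_right_mono prod_nonneg)
qed

text \<open>Without a prime in (n, 4 n + 1], the primorial of 4 n + 1 would be that of n, at most
  4^n for n a power of two. The Lcm would then be at most 4^n times a subexponential factor,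
  although it is at least 16^n.\<close>

lemma ex_prime_linear:
  "\<exists>C>0. \<forall>d\<ge>1. \<exists>p::nat. prime p \<and> 2 < p \<and> d \<le> p \<and> real p \<le> C * real d"
proof -
  have "eventually (\<lambda>n::nat. (4 * real n + 1) powr sqrt (4 * real n + 1) < 4 ^ n) at_top"
    by real_asymp
  then obtain n0 where n0: "\<And>n::nat. n \<ge> n0 \<Longrightarrow> (4 * real n + 1) powr sqrt (4 * real n + 1) < 4 ^ n"
    by (auto simp: eventually_at_top_linorder)
  \<comment> \<open>Searching above b d instead of d pushes the power of two beyond the threshold
    \<open>n0\<close> and beyond 2 for every d \<ge> 1, so small d need no separate treatment; the
    loss is a constant factor.\<close>
  define b where "b = n0 + 2"
  have step: "\<exists>p::nat. prime p \<and> 2 ^ i < p \<and> p \<le> 5 * 2 ^ i" if "2 ^ i \<ge> n0" for i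
  proof (rule ccontr)
    define n :: nat where "n = 2 ^ i"
    have n1: "n \<ge> 1" by (simp add: n_def)
    assume neg: "\<not> ?thesis"
    have none: "\<not> (prime p \<and> n < p \<and> p \<le> 4 * n + 1)" for p
    proof
      assume *: "prime p \<and> n < p \<and> p \<le> 4 * n + 1"
      then have "p \<le> 5 * n" using n1 by linarith
      then show False using * neg unfolding n_def by blast
    qed
    have eq: "{p. prime p \<and> p \<le> 4 * n + 1} = {p. prime p \<and> p \<le> n}"
      using none n1 by (auto simp: not_less)
    have "4 ^ n * 4 ^ n = (4::real) ^ (2 * n)" by (simp add: power_add mult_2)
    also have "\<dots> \<le> real (Lcm {1..4 * n + 1})"
      using of_nat_mono[OF four_power_le_Lcm[of "2 * n"], where ?'a = real] by simp
    also have "\<dots> \<le> real (4 * n + 1) powr sqrt (real (4 * n + 1)) * (\<Prod>p | prime p \<and> p \<le> n. real p)"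
      using Lcm_le_prod_primes[of "4 * n + 1"] unfolding eq by simp
    also have "\<dots> \<le> real (4 * n + 1) powr sqrt (real (4 * n + 1)) * 4 ^ n"
      using of_nat_mono[OF prod_primes_le_four_power[of i], where ?'a = real]
      by (intro mult_left_mono) (simp_all add: n_def)
    also have "\<dots> < 4 ^ n * 4 ^ n"
      using n0[of n] that by (intro mult_strict_right_mono) (simp_all add: n_def add.commute)
    finally show False by simp
  qed
  have "\<exists>p. prime p \<and> 2 < p \<and> d \<le> p \<and> real p \<le> 10 * 2 ^ b * real d" if d: "d \<ge> 1" for d :: nat
  proof -
    define i where "i = (LEAST i. b * d \<le> 2 ^ i)"
    have ex: "b * d \<le> 2 ^ (b * d)" by (simp add: less_imp_le)
    have i1: "b * d \<le> 2 ^ i" unfolding i_def using ex by (rule LeastI)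
    have "b * d \<ge> 2" using d by (cases d) (auto simp: b_def)
    then have i0: "i > 0" using i1 by (cases i) auto
    then have "\<not> b * d \<le> 2 ^ (i - 1)" unfolding i_def by (intro not_less_Least) (simp add: i_def)
    then have i2: "2 ^ i \<le> 2 * (b * d)" using i0 by (cases i) auto
    have "b \<le> b * d" using d by simp
    then have big: "2 ^ i \<ge> n0" "(2::nat) ^ i \<ge> 2" using i1 unfolding b_def by linarith+
    obtain p :: nat where p: "prime p" "2 ^ i < p" "p \<le> 5 * 2 ^ i" using step[OF big(1)] by blast
    have "d \<le> b * d" by (simp add: b_def)
    then have "d \<le> p" using i1 p by linarith
    moreover have "p \<le> 10 * b * d" using p i2 by simp
    then have "p \<le> 10 * 2 ^ b * d"
      by (rule order_trans) (simp add: less_imp_le)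
    then have "real p \<le> real (10 * 2 ^ b * d)" by (rule of_nat_mono)
    ultimately show ?thesis using p big by auto
  qed
  then show ?thesis by (intro exI[of _ "10 * 2 ^ b"]) auto
qed

section \<open>Testing closeness of two distributions in the Euclidean norm\<close>

text \<open>Lagrange's identity: twice the gap is the sum of the squares of all
  \<open>a i * b j - a j * b i\<close>.\<close>

lemma Cauchy_Schwarz_sum:
  fixes a b :: "'a \<Rightarrow> real"
  shows "(\<Sum>i\<in>I. a i * b i)\<^sup>2 \<le> (\<Sum>i\<in>I. (a i)\<^sup>2) * (\<Sum>i\<in>I. (b i)\<^sup>2)"
proof -
  have "0 \<le> (\<Sum>i\<in>I. \<Sum>j\<in>I. (a i * b j - a j * b i)\<^sup>2)"
    by (intro sum_nonneg) simp
  also have "\<dots> = (\<Sum>i\<in>I. \<Sum>j\<in>I. (a i)\<^sup>2 * (b j)\<^sup>2) + (\<Sum>i\<in>I. \<Sum>j\<in>I. (b i)\<^sup>2 * (a j)\<^sup>2)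
      - 2 * (\<Sum>i\<in>I. \<Sum>j\<in>I. (a i * b i) * (a j * b j))"
    by (simp add: power2_eq_square algebra_simps sum.distrib sum_subtractf sum_distrib_left)
  also have "\<dots> = 2 * ((\<Sum>i\<in>I. (a i)\<^sup>2) * (\<Sum>i\<in>I. (b i)\<^sup>2)) - 2 * (\<Sum>i\<in>I. a i * b i)\<^sup>2"
    by (subst (1 2 3) sum_product[symmetric]) (simp add: power2_eq_square mult.commute)
  finally show ?thesis by simp
qed

section \<open>Words and product distributions on them\<close>

definition words :: "nat \<Rightarrow> nat \<Rightarrow> nat list set" where
  "words n L = {xs. length xs = L \<and> set xs \<subseteq> {..<n}}"

lemma finite_words: "finite (words n L)"
  using finite_lists_length_eq[of "{..<n}" L] by (simp add: words_def conj_commute)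

lemma words_nth_less: "xs \<in> words n L \<Longrightarrow> i < L \<Longrightarrow> xs ! i < n"
  by (auto simp: words_def dest: nth_mem)

lemma words_Suc: "words n (Suc L) = (\<lambda>(x, xs). x # xs) ` ({..<n} \<times> words n L)"
  by (auto simp: words_def length_Suc_conv image_iff)

lemma sum_words_prod:
  fixes g :: "nat \<Rightarrow> nat \<Rightarrow> 'a :: comm_semiring_1"
  shows "(\<Sum>xs\<in>words n L. \<Prod>i<L. g i (xs ! i)) = (\<Prod>i<L. \<Sum>x<n. g i x)"
proof (induction L arbitrary: g)
  case 0
  have "words n 0 = {[]}" by (auto simp: words_def)
  then show ?case by simp
next
  case (Suc L)
  have inj: "inj_on (\<lambda>(x, xs). x # xs) ({..<n} \<times> words n L)"
    by (auto simp: inj_on_def)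
  have "(\<Sum>xs\<in>words n (Suc L). \<Prod>i<Suc L. g i (xs ! i))
      = (\<Sum>(x, xs)\<in>{..<n} \<times> words n L. g 0 x * (\<Prod>i<L. g (Suc i) (xs ! i)))"
    unfolding words_Suc
    by (subst sum.reindex[OF inj]) (simp add: case_prod_unfold prod.lessThan_Suc_shift del: prod.lessThan_Suc)
  also have "\<dots> = (\<Sum>x<n. g 0 x) * (\<Sum>xs\<in>words n L. \<Prod>i<L. g (Suc i) (xs ! i))"
    by (simp add: sum_product sum.cartesian_product)
  also have "\<dots> = (\<Prod>i<Suc L. \<Sum>x<n. g i x)"
    by (simp only: Suc.IH[of "\<lambda>i. g (Suc i)"] prod.lessThan_Suc_shift)
  finally show ?case .
qed

text \<open>Each position has its own law, so that the samples of both unknown distributions form a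
  single word.\<close>

locale product_distribution =
  fixes n L :: nat and P :: "nat \<Rightarrow> nat \<Rightarrow> real"
  assumes P_nonneg: "i < L \<Longrightarrow> x < n \<Longrightarrow> 0 \<le> P i x"
    and P_sum: "i < L \<Longrightarrow> (\<Sum>x<n. P i x) = 1"
begin

definition weight :: "nat list \<Rightarrow> real" where
  "weight xs = (\<Prod>i<L. P i (xs ! i))"

definition expect :: "(nat list \<Rightarrow> real) \<Rightarrow> real" where
  "expect G = (\<Sum>xs\<in>words n L. weight xs * G xs)"

definition mean :: "nat \<Rightarrow> (nat \<Rightarrow> real) \<Rightarrow> real" where
  "mean i a = (\<Sum>x<n. P i x * a x)"

lemma weight_nonneg: "xs \<in> words n L \<Longrightarrow> 0 \<le> weight xs"
  by (auto simp: weight_def intro!: prod_nonneg P_nonneg words_nth_less)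

lemma mean_one: "i < L \<Longrightarrow> mean i (\<lambda>_. 1) = 1"
  by (simp add: mean_def P_sum)

lemma expect_prod: "expect (\<lambda>xs. \<Prod>i<L. g i (xs ! i)) = (\<Prod>i<L. mean i (g i))"
  using sum_words_prod[where L = L and n = n and g = "\<lambda>i x. P i x * g i x"]
  by (simp add: expect_def weight_def mean_def prod.distrib)

lemma expect_one: "expect (\<lambda>_. 1) = 1"
  using expect_prod[of "\<lambda>_ _. 1"] by (simp add: mean_one)

lemma expect_add: "expect (\<lambda>xs. F xs + G xs) = expect F + expect G"
  by (simp add: expect_def distrib_left sum.distrib)

lemma expect_diff: "expect (\<lambda>xs. F xs - G xs) = expect F - expect G"
  by (simp add: expect_def right_diff_distrib sum_subtractf)

lemma expect_cmult: "expect (\<lambda>xs. c * F xs) = c * expect F"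
  by (simp add: expect_def sum_distrib_left mult_ac)

lemma expect_sum: "expect (\<lambda>xs. \<Sum>k\<in>K. F k xs) = (\<Sum>k\<in>K. expect (F k))"
  unfolding expect_def sum_distrib_left by (rule sum.swap)

lemma expect_mono:
  "(\<And>xs. xs \<in> words n L \<Longrightarrow> F xs \<le> G xs) \<Longrightarrow> expect F \<le> expect G"
  unfolding expect_def by (intro sum_mono mult_left_mono weight_nonneg)

text \<open>The hypothesis encodes independence: every position is ignored by one of the two
  products, so the mean at that position factors trivially.\<close>

lemma expect_indep:
  assumes "\<And>i. i < L \<Longrightarrow> g i = (\<lambda>_. 1) \<or> h i = (\<lambda>_. 1)"
  shows "expect (\<lambda>xs. (\<Prod>i<L. g i (xs ! i)) * (\<Prod>i<L. h i (xs ! i)))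
    = expect (\<lambda>xs. \<Prod>i<L. g i (xs ! i)) * expect (\<lambda>xs. \<Prod>i<L. h i (xs ! i))"
proof -
  have "mean i (\<lambda>x. g i x * h i x) = mean i (g i) * mean i (h i)" if "i < L" for i
    using assms[OF that] mean_one[OF that] by auto
  then have "(\<Prod>i<L. mean i (\<lambda>x. g i x * h i x)) = (\<Prod>i<L. mean i (g i) * mean i (h i))"
    by (intro prod.cong) auto
  then show ?thesis
    using expect_prod[of "\<lambda>i x. g i x * h i x"] by (simp add: expect_prod prod.distrib)
qed

text \<open>Pads a function of one letter by the constant 1 at all other positions, which brings
  products of few letters into the shape required by \<open>expect_prod\<close>.\<close>

definition at_pos :: "nat \<Rightarrow> (nat \<Rightarrow> real) \<Rightarrow> nat \<Rightarrow> nat \<Rightarrow> real" where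
  "at_pos i a k x = (if k = i then a x else 1)"

lemma factor_as_prod:
  assumes "i < L" "j < L"
  shows "a (xs ! i) * b (xs ! j) = (\<Prod>k<L. at_pos i a k (xs ! k) * at_pos j b k (xs ! k))"
  using assms by (simp add: prod.distrib at_pos_def)

text \<open>The correction for \<open>i = j\<close> is the covariance of two functions of the same
  letter; stating both cases in one equation lets double sums over positions be evaluated at
  once.\<close>

lemma expect_pair:
  assumes "i < L" "j < L"
  shows "expect (\<lambda>xs. a (xs ! i) * b (xs ! j))
    = mean i a * mean j b + (if i = j then mean i (\<lambda>x. a x * b x) - mean i a * mean i b else 0)"
proof -
  have *: "expect (\<lambda>xs. a (xs ! i) * b (xs ! j))
      = (\<Prod>k<L. mean k (\<lambda>x. at_pos i a k x * at_pos j b k x))"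
    unfolding factor_as_prod[OF assms]
    using expect_prod[of "\<lambda>k x. at_pos i a k x * at_pos j b k x"] by simp
  show ?thesis
  proof (cases "i = j")
    case True
    have "(\<Prod>k<L. mean k (\<lambda>x. at_pos i a k x * at_pos j b k x))
        = (\<Prod>k<L. if k = i then mean k (\<lambda>x. a x * b x) else 1)"
      by (rule prod.cong) (auto simp: mean_one at_pos_def True)
    then show ?thesis using True assms * by simp
  next
    case False
    have "(\<Prod>k<L. mean k (\<lambda>x. at_pos i a k x * at_pos j b k x))
        = (\<Prod>k<L. (if k = i then mean k a else 1) * (if k = j then mean k b else 1))"
      by (rule prod.cong) (use False in \<open>auto simp: mean_one at_pos_def\<close>)
    then show ?thesis using False assms * by (simp add: prod.distrib)
  qed
qed

text \<open>Positions may coincide within a pair; only the two pairs must be disjoint. This is what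
  the second moment of a product of two half counts requires.\<close>

lemma expect_quad:
  assumes "i < L" "i' < L" "j < L" "j' < L" "{i, i'} \<inter> {j, j'} = {}"
  shows "expect (\<lambda>xs. (a (xs ! i) * a' (xs ! i')) * (b (xs ! j) * b' (xs ! j')))
    = expect (\<lambda>xs. a (xs ! i) * a' (xs ! i')) * expect (\<lambda>xs. b (xs ! j) * b' (xs ! j'))"
  unfolding factor_as_prod[OF assms(1,2)] factor_as_prod[OF assms(3,4)]
proof (rule expect_indep[where g = "\<lambda>k x. at_pos i a k x * at_pos i' a' k x"
      and h = "\<lambda>k x. at_pos j b k x * at_pos j' b' k x"])
  fix k
  show "(\<lambda>x. at_pos i a k x * at_pos i' a' k x) = (\<lambda>_. 1)
      \<or> (\<lambda>x. at_pos j b k x * at_pos j' b' k x) = (\<lambda>_. 1)"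
    using assms(5) by (cases "k \<in> {i, i'}") (auto simp: at_pos_def fun_eq_iff)
qed

lemma expect_sum_pair:
  assumes "A \<subseteq> {..<L}"
  shows "expect (\<lambda>xs. (\<Sum>i\<in>A. a i (xs ! i)) * (\<Sum>i\<in>A. b i (xs ! i)))
    = (\<Sum>i\<in>A. mean i (a i)) * (\<Sum>i\<in>A. mean i (b i))
      + (\<Sum>i\<in>A. mean i (\<lambda>x. a i x * b i x) - mean i (a i) * mean i (b i))"
proof -
  have fin: "finite A" using assms finite_subset by blast
  have "expect (\<lambda>xs. (\<Sum>i\<in>A. a i (xs ! i)) * (\<Sum>i\<in>A. b i (xs ! i)))
      = (\<Sum>i\<in>A. \<Sum>j\<in>A. expect (\<lambda>xs. a i (xs ! i) * b j (xs ! j)))"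
    by (simp add: sum_product expect_sum)
  also have "\<dots> = (\<Sum>i\<in>A. \<Sum>j\<in>A. mean i (a i) * mean j (b j)
      + (if i = j then mean i (\<lambda>x. a i x * b j x) - mean i (a i) * mean i (b j) else 0))"
    using assms by (intro sum.cong refl expect_pair) auto
  also have "\<dots> = (\<Sum>i\<in>A. mean i (a i)) * (\<Sum>i\<in>A. mean i (b i))
      + (\<Sum>i\<in>A. mean i (\<lambda>x. a i x * b i x) - mean i (a i) * mean i (b i))"
    using fin by (simp add: sum.distrib sum_product)
  finally show ?thesis .
qed

lemma expect_sum_quad:
  assumes "A \<subseteq> {..<L}" "B \<subseteq> {..<L}" "A \<inter> B = {}"
  shows "expect (\<lambda>xs. ((\<Sum>i\<in>A. a i (xs ! i)) * (\<Sum>i\<in>A. a' i (xs ! i)))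
      * ((\<Sum>j\<in>B. b j (xs ! j)) * (\<Sum>j\<in>B. b' j (xs ! j))))
    = expect (\<lambda>xs. (\<Sum>i\<in>A. a i (xs ! i)) * (\<Sum>i\<in>A. a' i (xs ! i)))
      * expect (\<lambda>xs. (\<Sum>j\<in>B. b j (xs ! j)) * (\<Sum>j\<in>B. b' j (xs ! j)))"
proof -
  have "expect (\<lambda>xs. ((\<Sum>i\<in>A. a i (xs ! i)) * (\<Sum>i\<in>A. a' i (xs ! i)))
      * ((\<Sum>j\<in>B. b j (xs ! j)) * (\<Sum>j\<in>B. b' j (xs ! j))))
    = (\<Sum>(i, i')\<in>A \<times> A. \<Sum>(j, j')\<in>B \<times> B.
        expect (\<lambda>xs. (a i (xs ! i) * a' i' (xs ! i')) * (b j (xs ! j) * b' j' (xs ! j'))))"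
    by (simp only: sum_product sum.cartesian_product expect_sum case_prod_unfold)
  also have "\<dots> = (\<Sum>(i, i')\<in>A \<times> A. \<Sum>(j, j')\<in>B \<times> B.
        expect (\<lambda>xs. a i (xs ! i) * a' i' (xs ! i')) * expect (\<lambda>xs. b j (xs ! j) * b' j' (xs ! j')))"
    unfolding case_prod_unfold using assms by (intro sum.cong refl expect_quad) auto
  also have "\<dots> = (\<Sum>(i, i')\<in>A \<times> A. expect (\<lambda>xs. a i (xs ! i) * a' i' (xs ! i')))
      * (\<Sum>(j, j')\<in>B \<times> B. expect (\<lambda>xs. b j (xs ! j) * b' j' (xs ! j')))"
    by (simp only: sum_product case_prod_unfold)
  also have "\<dots> = expect (\<lambda>xs. (\<Sum>i\<in>A. a i (xs ! i)) * (\<Sum>i\<in>A. a' i (xs ! i)))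
      * expect (\<lambda>xs. (\<Sum>j\<in>B. b j (xs ! j)) * (\<Sum>j\<in>B. b' j (xs ! j)))"
    by (simp only: sum_product sum.cartesian_product expect_sum case_prod_unfold)
  finally show ?thesis .
qed

text \<open>Stated for any event that forces a deviation, so that a wrong verdict can be inserted
  for \<open>bad\<close> directly.\<close>

lemma chebyshev:
  assumes t: "t > 0"
    and far: "\<And>xs. xs \<in> words n L \<Longrightarrow> bad xs \<Longrightarrow> t \<le> \<bar>Z xs - expect Z\<bar>"
  shows "(\<Sum>xs | xs \<in> words n L \<and> bad xs. weight xs)
    \<le> (expect (\<lambda>xs. (Z xs)\<^sup>2) - (expect Z)\<^sup>2) / t\<^sup>2"
proof -
  have "(\<Sum>xs | xs \<in> words n L \<and> bad xs. weight xs) = expect (\<lambda>xs. if bad xs then 1 else 0)"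
    unfolding expect_def by (simp add: sum.If_cases finite_words Int_def if_distrib cong: if_cong)
  also have "\<dots> \<le> expect (\<lambda>xs. (1 / t\<^sup>2) * (Z xs - expect Z)\<^sup>2)"
  proof (rule expect_mono)
    fix xs assume xs: "xs \<in> words n L"
    show "(if bad xs then 1 else 0) \<le> (1 / t\<^sup>2) * (Z xs - expect Z)\<^sup>2"
      using power_mono[OF far[OF xs], of 2] t by (auto simp: field_simps)
  qed
  also have "\<dots> = (1 / t\<^sup>2) * expect (\<lambda>xs. (Z xs - expect Z)\<^sup>2)"
    by (rule expect_cmult)
  \<comment> \<open>The trailing factor 1 puts the constant term into a form to which
    \<open>expect_cmult\<close> and \<open>expect_one\<close> apply.\<close>
  also have "expect (\<lambda>xs. (Z xs - expect Z)\<^sup>2)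
      = expect (\<lambda>xs. ((Z xs)\<^sup>2 - 2 * expect Z * Z xs) + (expect Z)\<^sup>2 * 1)"
    by (simp add: power2_diff algebra_simps)
  also have "\<dots> = expect (\<lambda>xs. (Z xs)\<^sup>2) - (expect Z)\<^sup>2"
    unfolding expect_add expect_diff expect_cmult expect_one by (simp add: power2_eq_square)
  finally show ?thesis by simp
qed

end

section \<open>The two-sample collision statistic\<close>

definition first_half :: "nat \<Rightarrow> nat set" where
  "first_half m = {..<m} \<union> {2 * m..<3 * m}"

definition second_half :: "nat \<Rightarrow> nat set" where
  "second_half m = {m..<2 * m} \<union> {3 * m..<4 * m}"

lemma sum_half:
  fixes f :: "bool \<Rightarrow> real"
  assumes "H = first_half m \<or> H = second_half m"
  shows "(\<Sum>i\<in>H. f (i < 2 * m)) = real m * (f True + f False)"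
proof -
  have main: "(\<Sum>i\<in>{a..<a + m} \<union> {b..<b + m}. f (i < 2 * m)) = real m * (f True + f False)"
    if "a + m \<le> 2 * m" "2 * m \<le> b" for a b
  proof -
    have "(\<Sum>i\<in>{a..<a + m}. f (i < 2 * m)) = (\<Sum>i\<in>{a..<a + m}. f True)"
      using that by (intro sum.cong) auto
    moreover have "(\<Sum>i\<in>{b..<b + m}. f (i < 2 * m)) = (\<Sum>i\<in>{b..<b + m}. f False)"
      using that by (intro sum.cong) auto
    ultimately show ?thesis
      using that by (subst sum.union_disjoint) (auto simp: algebra_simps)
  qed
  from assms show ?thesis
  proof
    assume "H = first_half m"
    then have H: "H = {0..<0 + m} \<union> {2 * m..<2 * m + m}" by (auto simp: first_half_def)
    show ?thesis unfolding H by (rule main) auto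
  next
    assume "H = second_half m"
    then have H: "H = {m..<m + m} \<union> {3 * m..<3 * m + m}" by (auto simp: second_half_def)
    show ?thesis unfolding H by (rule main) auto
  qed
qed

text \<open>A word of length \<open>4 * m\<close> consists of \<open>2 * m\<close> samples of \<open>p\<close> followed by \<open>2 * m\<close> samples of \<open>q\<close>.
  Each half contributes an unbiased estimate of \<open>m * (p x - q x)\<close>, and the two are independent.\<close>

definition half_count :: "nat \<Rightarrow> nat set \<Rightarrow> nat \<Rightarrow> nat list \<Rightarrow> real" where
  "half_count m H x xs = (\<Sum>i\<in>H. (if i < 2 * m then 1 else - 1) * of_bool (xs ! i = x))"

text \<open>Squaring one count would add its variance to the mean. A product of counts from disjoint
  samples is unbiased for m^2 (p x - q x)^2, and its second moments factor into expectations of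
  degree two.\<close>

definition l2_statistic :: "nat \<Rightarrow> nat \<Rightarrow> nat list \<Rightarrow> real" where
  "l2_statistic n m xs = (\<Sum>x<n. half_count m (first_half m) x xs * half_count m (second_half m) x xs)"

locale two_samples =
  fixes n m :: nat and p q :: "nat \<Rightarrow> real"
  assumes p_nonneg: "x < n \<Longrightarrow> 0 \<le> p x" and p_sum: "(\<Sum>x<n. p x) = 1"
    and q_nonneg: "x < n \<Longrightarrow> 0 \<le> q x" and q_sum: "(\<Sum>x<n. q x) = 1"
begin

sublocale product_distribution n "4 * m" "\<lambda>i. if i < 2 * m then p else q"
  by unfold_locales (auto simp: p_nonneg q_nonneg p_sum q_sum)

text \<open>\<open>real m * cov x y\<close> is the covariance of the counts of x and y in one half:
  m multinomial covariances from each of the two samples, the sign of the second sample cancelling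
  in products.\<close>

definition cov :: "nat \<Rightarrow> nat \<Rightarrow> real" where
  "cov x y = of_bool (x = y) * (p x + q x) - p x * p y - q x * q y"

definition dist_sq :: real where
  "dist_sq = (\<Sum>x<n. (p x - q x)\<^sup>2)"

lemma mean_indicator:
  "x < n \<Longrightarrow> mean i (\<lambda>y. c * of_bool (y = x)) = c * (if i < 2 * m then p else q) x"
proof -
  assume x: "x < n"
  have "mean i (\<lambda>y. c * of_bool (y = x))
      = (\<Sum>y<n. if y = x then c * (if i < 2 * m then p else q) y else 0)"
    unfolding mean_def by (rule sum.cong) auto
  then show ?thesis using x by simp
qed

lemma sum_mean_signed:
  assumes H: "H = first_half m \<or> H = second_half m" and x: "x < n"
  shows "(\<Sum>i\<in>H. mean i (\<lambda>z. (if i < 2 * m then 1 else - 1) * of_bool (z = x))) = real m * (p x - q x)"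
proof -
  have "(\<Sum>i\<in>H. mean i (\<lambda>z. (if i < 2 * m then 1 else - 1) * of_bool (z = x)))
      = (\<Sum>i\<in>H. (\<lambda>b. if b then p x else - q x) (i < 2 * m))"
    unfolding mean_indicator[OF x] by (rule sum.cong) auto
  then show ?thesis using sum_half[OF H, of "\<lambda>b. if b then p x else - q x"] by simp
qed

lemma expect_half_count_mult:
  assumes H: "H = first_half m \<or> H = second_half m" and xy: "x < n" "y < n"
  shows "expect (\<lambda>xs. half_count m H x xs * half_count m H y xs)
    = real m ^ 2 * ((p x - q x) * (p y - q y)) + real m * cov x y"
proof -
  define s :: "nat \<Rightarrow> real" where "s i = (if i < 2 * m then 1 else - 1)" for i
  have s2: "s i * s i = 1" for i by (simp add: s_def)
  have sub: "H \<subseteq> {..<4 * m}" using H by (auto simp: first_half_def second_half_def)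
  have mean_sum: "(\<Sum>i\<in>H. mean i (\<lambda>z. s i * of_bool (z = x))) = real m * (p x - q x)"
    if "x < n" for x
    unfolding s_def using sum_mean_signed[OF H that] .
  have prod: "mean i (\<lambda>z. s i * of_bool (z = x) * (s i * of_bool (z = y)))
      = of_bool (x = y) * (if i < 2 * m then p else q) x" for i
  proof -
    have "(\<lambda>z. s i * of_bool (z = x) * (s i * of_bool (z = y)))
        = (\<lambda>z. of_bool (x = y) * of_bool (z = x))"
      using s2[of i] by (auto simp: fun_eq_iff)
    then show ?thesis by (simp only: mean_indicator[OF xy(1)])
  qed
  have "expect (\<lambda>xs. half_count m H x xs * half_count m H y xs)
      = (\<Sum>i\<in>H. mean i (\<lambda>z. s i * of_bool (z = x))) * (\<Sum>i\<in>H. mean i (\<lambda>z. s i * of_bool (z = y)))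
        + (\<Sum>i\<in>H. mean i (\<lambda>z. s i * of_bool (z = x) * (s i * of_bool (z = y)))
            - mean i (\<lambda>z. s i * of_bool (z = x)) * mean i (\<lambda>z. s i * of_bool (z = y)))"
    unfolding half_count_def s_def[symmetric]
    by (rule expect_sum_pair[OF sub])
  also have "(\<Sum>i\<in>H. mean i (\<lambda>z. s i * of_bool (z = x) * (s i * of_bool (z = y)))
            - mean i (\<lambda>z. s i * of_bool (z = x)) * mean i (\<lambda>z. s i * of_bool (z = y)))
      = (\<Sum>i\<in>H. (\<lambda>b. of_bool (x = y) * (if b then p else q) x
            - (if b then p else q) x * (if b then p else q) y) (i < 2 * m))"
    unfolding prod mean_indicator[OF xy(1)] mean_indicator[OF xy(2)]
    by (rule sum.cong) (auto simp: s_def)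
  also have "\<dots> = real m * cov x y"
    by (subst sum_half[OF H]) (simp add: cov_def algebra_simps)
  finally show ?thesis
    unfolding mean_sum[OF xy(1)] mean_sum[OF xy(2)] by (simp add: power2_eq_square)
qed

lemma expect_half_count_quad:
  "expect (\<lambda>xs. (half_count m (first_half m) x xs * half_count m (first_half m) y xs)
      * (half_count m (second_half m) x xs * half_count m (second_half m) y xs))
    = expect (\<lambda>xs. half_count m (first_half m) x xs * half_count m (first_half m) y xs)
      * expect (\<lambda>xs. half_count m (second_half m) x xs * half_count m (second_half m) y xs)"
  unfolding half_count_def
  by (rule expect_sum_quad) (auto simp: first_half_def second_half_def)

text \<open>A position of one half never equals a position of the other, so no covariance term of
  \<open>expect_pair\<close> survives.\<close>

lemma expect_half_count_first_second:
  assumes x: "x < n"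
  shows "expect (\<lambda>xs. half_count m (first_half m) x xs * half_count m (second_half m) x xs)
    = real m ^ 2 * (p x - q x)\<^sup>2"
proof -
  define s :: "nat \<Rightarrow> real" where "s i = (if i < 2 * m then 1 else - 1)" for i
  define c where "c i z = s i * of_bool (z = x)" for i z
  have mean_sum: "(\<Sum>i\<in>H. mean i (c i)) = real m * (p x - q x)"
    if "H = first_half m \<or> H = second_half m" for H
    unfolding s_def c_def[abs_def] using sum_mean_signed[OF that x] .
  have "expect (\<lambda>xs. half_count m (first_half m) x xs * half_count m (second_half m) x xs)
      = (\<Sum>i\<in>first_half m. \<Sum>j\<in>second_half m. expect (\<lambda>xs. c i (xs ! i) * c j (xs ! j)))"
    unfolding half_count_def s_def[symmetric] c_def by (simp only: sum_product expect_sum)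
  also have "\<dots> = (\<Sum>i\<in>first_half m. \<Sum>j\<in>second_half m. mean i (c i) * mean j (c j))"
  proof (intro sum.cong refl)
    fix i j assume "i \<in> first_half m" "j \<in> second_half m"
    then have "i < 4 * m" "j < 4 * m" "i \<noteq> j" by (auto simp: first_half_def second_half_def)
    then show "expect (\<lambda>xs. c i (xs ! i) * c j (xs ! j)) = mean i (c i) * mean j (c j)"
      by (simp add: expect_pair)
  qed
  also have "\<dots> = real m ^ 2 * (p x - q x)\<^sup>2"
    unfolding sum_product[symmetric] by (simp add: mean_sum power2_eq_square)
  finally show ?thesis .
qed

lemma expect_l2_statistic: "expect (l2_statistic n m) = real m ^ 2 * dist_sq"
proof -
  have "expect (l2_statistic n m) = (\<Sum>x<n. real m ^ 2 * (p x - q x)\<^sup>2)"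
    unfolding l2_statistic_def[abs_def] expect_sum
    by (rule sum.cong) (simp_all add: expect_half_count_first_second)
  then show ?thesis by (simp add: dist_sq_def sum_distrib_left)
qed

text \<open>The two halves are independent and have the same second moments, so each product of
  expectations is a square.\<close>

lemma expect_l2_statistic_sq:
  "expect (\<lambda>xs. (l2_statistic n m xs)\<^sup>2)
    = (\<Sum>x<n. \<Sum>y<n. (real m ^ 2 * ((p x - q x) * (p y - q y)) + real m * cov x y)\<^sup>2)"
proof -
  have "expect (\<lambda>xs. (l2_statistic n m xs)\<^sup>2)
    = (\<Sum>x<n. \<Sum>y<n. expect (\<lambda>xs.
       (half_count m (first_half m) x xs * half_count m (first_half m) y xs)
      * (half_count m (second_half m) x xs * half_count m (second_half m) y xs)))"
    by (simp add: l2_statistic_def power2_eq_square sum_product mult.assoc mult.left_commute flip: expect_sum)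
  also have "\<dots> = (\<Sum>x<n. \<Sum>y<n. (real m ^ 2 * ((p x - q x) * (p y - q y)) + real m * cov x y)\<^sup>2)"
    by (intro sum.cong refl) (simp add: expect_half_count_quad expect_half_count_mult power2_eq_square)
  finally show ?thesis .
qed

text \<open>Let \<open>w\<close> be the outer product of p - q with itself; its Frobenius norm is
  \<open>dist_sq\<close>. Expanding (m^2 w + m cov)^2, the \<open>w\<close> squares sum to the
  squared mean and cancel, and Cauchy-Schwarz bounds the mixed term. The parameter \<open>s\<close>
  is any bound on the Frobenius norm of \<open>cov\<close>.\<close>

lemma variance_l2_statistic:
  assumes s: "0 \<le> s" "(\<Sum>x<n. \<Sum>y<n. (cov x y)\<^sup>2) \<le> s\<^sup>2"
  shows "expect (\<lambda>xs. (l2_statistic n m xs)\<^sup>2) - (expect (l2_statistic n m))\<^sup>2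
    \<le> real m ^ 2 * s\<^sup>2 + 2 * real m ^ 3 * (s * dist_sq)"
proof -
  define w where "w x y = (p x - q x) * (p y - q y)" for x y
  have D: "0 \<le> dist_sq" by (simp add: dist_sq_def sum_nonneg)
  have ww: "(\<Sum>x<n. \<Sum>y<n. (w x y)\<^sup>2) = dist_sq\<^sup>2"
    by (simp add: dist_sq_def power2_eq_square sum_product w_def mult_ac)
  have "expect (\<lambda>xs. (l2_statistic n m xs)\<^sup>2)
      = (\<Sum>x<n. \<Sum>y<n. real m ^ 4 * (w x y)\<^sup>2 + 2 * real m ^ 3 * (cov x y * w x y) + real m ^ 2 * (cov x y)\<^sup>2)"
    unfolding expect_l2_statistic_sq w_def[symmetric]
    by (intro sum.cong refl) (simp add: power2_eq_square power3_eq_cube power4_eq_xxxx algebra_simps)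
  also have "\<dots> = real m ^ 4 * dist_sq\<^sup>2 + 2 * real m ^ 3 * (\<Sum>x<n. \<Sum>y<n. cov x y * w x y)
      + real m ^ 2 * (\<Sum>x<n. \<Sum>y<n. (cov x y)\<^sup>2)"
    unfolding ww[symmetric] by (simp only: sum.distrib sum_distrib_left)
  finally have eq: "expect (\<lambda>xs. (l2_statistic n m xs)\<^sup>2) - (expect (l2_statistic n m))\<^sup>2
      = 2 * real m ^ 3 * (\<Sum>x<n. \<Sum>y<n. cov x y * w x y) + real m ^ 2 * (\<Sum>x<n. \<Sum>y<n. (cov x y)\<^sup>2)"
    by (simp add: expect_l2_statistic power_mult_distrib flip: power_mult)
  have "(\<Sum>x<n. \<Sum>y<n. cov x y * w x y)\<^sup>2 \<le> (\<Sum>x<n. \<Sum>y<n. (cov x y)\<^sup>2) * (\<Sum>x<n. \<Sum>y<n. (w x y)\<^sup>2)"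
    using Cauchy_Schwarz_sum[of "\<lambda>(x, y). cov x y" "\<lambda>(x, y). w x y" "{..<n} \<times> {..<n}"]
    by (simp add: sum.cartesian_product case_prod_unfold)
  also have "\<dots> \<le> s\<^sup>2 * dist_sq\<^sup>2" unfolding ww using s by (intro mult_right_mono) auto
  finally have "(\<Sum>x<n. \<Sum>y<n. cov x y * w x y)\<^sup>2 \<le> (s * dist_sq)\<^sup>2"
    unfolding power_mult_distrib .
  then have "(\<Sum>x<n. \<Sum>y<n. cov x y * w x y) \<le> s * dist_sq"
    by (rule power2_le_imp_le) (use s D in simp)
  then have "2 * real m ^ 3 * (\<Sum>x<n. \<Sum>y<n. cov x y * w x y) \<le> 2 * real m ^ 3 * (s * dist_sq)"
    by (intro mult_left_mono) auto
  moreover have "real m ^ 2 * (\<Sum>x<n. \<Sum>y<n. (cov x y)\<^sup>2) \<le> real m ^ 2 * s\<^sup>2"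
    using s by (intro mult_left_mono) auto
  ultimately show ?thesis unfolding eq by simp
qed

lemma sum_sq_le_one:
  fixes f :: "nat \<Rightarrow> real"
  assumes "\<And>x. x < n \<Longrightarrow> 0 \<le> f x" "(\<Sum>x<n. f x) = 1"
  shows "(\<Sum>x<n. (f x)\<^sup>2) \<le> 1"
proof -
  have "(\<Sum>x<n. (f x)\<^sup>2) \<le> (\<Sum>x<n. f x * 1)"
  proof (rule sum_mono)
    fix x assume "x \<in> {..<n}"
    moreover have "f x \<le> (\<Sum>x<n. f x)"
      using assms(1) calculation by (intro member_le_sum) auto
    ultimately show "(f x)\<^sup>2 \<le> f x * 1"
      using assms unfolding power2_eq_square by (intro mult_left_mono) auto
  qed
  then show ?thesis using assms(2) by simp
qed

text \<open>Splitting \<open>cov\<close> into its diagonal part and two outer products costs a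
  factor 3. The diagonal part gives 2 (a + b), where a and b are the collision probabilities, and
  the outer products give a^2 + b^2 \<le> a + b because a and b are at most 1. The total is 3 (2 +
  1) = 9 times a + b.\<close>

lemma cov_frobenius:
  "(\<Sum>x<n. \<Sum>y<n. (cov x y)\<^sup>2) \<le> 9 * ((\<Sum>x<n. (p x)\<^sup>2) + (\<Sum>x<n. (q x)\<^sup>2))"
proof -
  define a where "a = (\<Sum>x<n. (p x)\<^sup>2)"
  define b where "b = (\<Sum>x<n. (q x)\<^sup>2)"
  have ab: "0 \<le> a" "0 \<le> b" "a \<le> 1" "b \<le> 1"
    unfolding a_def b_def
    by (auto intro!: sum_nonneg sum_sq_le_one p_nonneg q_nonneg p_sum q_sum)
  have sq: "(u - v - w)\<^sup>2 \<le> 3 * (u\<^sup>2 + v\<^sup>2 + w\<^sup>2)" for u v w :: real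
    using zero_le_power2[of "u + v"] zero_le_power2[of "u + w"] zero_le_power2[of "v - w"]
    by (simp add: power2_eq_square algebra_simps)
  have sq2: "(u + v)\<^sup>2 \<le> 2 * (u\<^sup>2 + v\<^sup>2)" for u v :: real
    using zero_le_power2[of "u - v"] by (simp add: power2_eq_square algebra_simps)
  have "(\<Sum>x<n. \<Sum>y<n. (cov x y)\<^sup>2)
      \<le> (\<Sum>x<n. \<Sum>y<n. 3 * (of_bool (x = y) * (2 * ((p x)\<^sup>2 + (q x)\<^sup>2)) + (p x * p y)\<^sup>2 + (q x * q y)\<^sup>2))"
  proof (intro sum_mono)
    fix x y
    define u where "u = of_bool (x = y) * (p x + q x)"
    define U where "U = of_bool (x = y) * (2 * ((p x)\<^sup>2 + (q x)\<^sup>2))"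
    have "u\<^sup>2 \<le> U" unfolding u_def U_def using sq2 by simp
    then have "(u - p x * p y - q x * q y)\<^sup>2 \<le> 3 * (U + (p x * p y)\<^sup>2 + (q x * q y)\<^sup>2)"
      by (intro order_trans[OF sq[of u "p x * p y" "q x * q y"]] mult_left_mono add_right_mono) auto
    then show "(cov x y)\<^sup>2 \<le> 3 * (of_bool (x = y) * (2 * ((p x)\<^sup>2 + (q x)\<^sup>2)) + (p x * p y)\<^sup>2 + (q x * q y)\<^sup>2)"
      unfolding cov_def u_def U_def .
  qed
  also have "\<dots> = 3 * ((\<Sum>x<n. \<Sum>y<n. of_bool (x = y) * (2 * ((p x)\<^sup>2 + (q x)\<^sup>2)))
      + (\<Sum>x<n. \<Sum>y<n. (p x * p y)\<^sup>2) + (\<Sum>x<n. \<Sum>y<n. (q x * q y)\<^sup>2))"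
    by (simp only: sum.distrib sum_distrib_left[symmetric])
  also have "(\<Sum>x<n. \<Sum>y<n. of_bool (x = y) * (2 * ((p x)\<^sup>2 + (q x)\<^sup>2))) = 2 * (a + b)"
    by (simp add: of_bool_def if_distrib[where f = "\<lambda>t. t * _"] a_def b_def sum.distrib sum_distrib_left cong: if_cong)
  also have "(\<Sum>x<n. \<Sum>y<n. (p x * p y)\<^sup>2) = a * a"
    by (simp add: a_def sum_product power_mult_distrib)
  also have "(\<Sum>x<n. \<Sum>y<n. (q x * q y)\<^sup>2) = b * b"
    by (simp add: b_def sum_product power_mult_distrib)
  also have "3 * (2 * (a + b) + a * a + b * b) \<le> 9 * (a + b)"
    using mult_left_mono[OF ab(3,1)] mult_left_mono[OF ab(4,2)] by simp
  finally show ?thesis unfolding a_def b_def .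
qed

text \<open>The statistic has mean 0 if the distributions agree and at least m^2 \<eta> if they are
  far apart; the threshold lies halfway. The number \<open>r\<close> is the scale of the l_2 norms
  of \<open>p\<close> and \<open>q\<close>.\<close>

lemma l2_test:
  assumes r: "0 \<le> r" "(\<Sum>x<n. (p x)\<^sup>2) \<le> 2 * r\<^sup>2" "(\<Sum>x<n. (q x)\<^sup>2) \<le> 2 * r\<^sup>2"
    and \<eta>: "0 < \<eta>" "192 * r \<le> real m * \<eta>" and m: "0 < m"
  shows "(\<And>x. x < n \<Longrightarrow> p x = q x) \<Longrightarrow>
      (\<Sum>xs | xs \<in> words n (4 * m) \<and> \<not> l2_statistic n m xs < real m ^ 2 * \<eta> / 2. weight xs) \<le> 1 / 3"
    and "\<eta> \<le> dist_sq \<Longrightarrow>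
      (\<Sum>xs | xs \<in> words n (4 * m) \<and> l2_statistic n m xs < real m ^ 2 * \<eta> / 2. weight xs) \<le> 1 / 3"
proof -
  \<comment> \<open>The Frobenius bound 9 (2 r^2 + 2 r^2) is the square of 6 r.\<close>
  define s where "s = 6 * r"
  have s0: "0 \<le> s" using r by (simp add: s_def)
  have "(\<Sum>x<n. \<Sum>y<n. (cov x y)\<^sup>2) \<le> 9 * (2 * r\<^sup>2 + 2 * r\<^sup>2)"
    using cov_frobenius r by (smt (verit))
  then have s2: "(\<Sum>x<n. \<Sum>y<n. (cov x y)\<^sup>2) \<le> s\<^sup>2"
    by (simp add: s_def power2_eq_square)
  note var = variance_l2_statistic[OF s0 s2]
  \<comment> \<open>One estimate for both errors: e = \<eta> with D = 0 for equal distributions, and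
    e = D = \<open>dist_sq\<close> for distant ones, where the deviation must be measured on the
    scale of \<open>dist_sq\<close> because the variance grows with it. With t = s / (m e) the
    quotient is at most 4 t^2 + 8 t, and 192 = 6 * 32 gives t \<le> 1 / 32, hence a value below 1 /
    3.\<close>
  have key: "(real m ^ 2 * s\<^sup>2 + 2 * real m ^ 3 * (s * D)) / (real m ^ 2 * e / 2)\<^sup>2 \<le> 1 / 3"
    if "\<eta> \<le> e" "0 \<le> D" "D \<le> e" for e D
  proof -
    define t where "t = s / (real m * e)"
    have e: "0 < e" "0 < real m * e" using that \<eta> m by auto
    have "real m * \<eta> \<le> real m * e" using that by (intro mult_left_mono) auto
    then have "s * 32 \<le> real m * e" using \<eta> s_def by linarith
    then have t: "0 \<le> t" "t \<le> 1 / 32" using s0 e by (auto simp: t_def field_simps)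
    have "real m ^ 2 * s\<^sup>2 + 2 * real m ^ 3 * (s * D) \<le> real m ^ 2 * s\<^sup>2 + 2 * real m ^ 3 * (s * e)"
      using that s0 by (intro add_left_mono mult_left_mono) auto
    then have "(real m ^ 2 * s\<^sup>2 + 2 * real m ^ 3 * (s * D)) / (real m ^ 2 * e / 2)\<^sup>2
        \<le> (real m ^ 2 * s\<^sup>2 + 2 * real m ^ 3 * (s * e)) / (real m ^ 2 * e / 2)\<^sup>2"
      by (rule divide_right_mono) simp
    also have "\<dots> = 4 * (t * t) + 8 * t"
    proof -
      have s: "s = t * (real m * e)" using e m by (simp add: t_def)
      have "real m ^ 2 * s\<^sup>2 + 2 * real m ^ 3 * (s * e)
          = (4 * (t * t) + 8 * t) * (real m ^ 2 * e / 2)\<^sup>2"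
        unfolding s by (simp add: power2_eq_square power3_eq_cube algebra_simps)
      moreover have "(real m ^ 2 * e / 2)\<^sup>2 \<noteq> 0" using e m by simp
      ultimately show ?thesis by simp
    qed
    also have "\<dots> \<le> 4 * (1 / 32 * (1 / 32)) + 8 * (1 / 32)"
      using t by (intro add_mono mult_mono) auto
    also have "\<dots> \<le> (1 / 3 :: real)" by simp
    finally show ?thesis .
  qed
  show "(\<Sum>xs | xs \<in> words n (4 * m) \<and> \<not> l2_statistic n m xs < real m ^ 2 * \<eta> / 2. weight xs) \<le> 1 / 3"
    if eq: "\<And>x. x < n \<Longrightarrow> p x = q x"
  proof -
    have D: "dist_sq = 0" by (simp add: dist_sq_def eq)
    have "(\<Sum>xs | xs \<in> words n (4 * m) \<and> \<not> l2_statistic n m xs < real m ^ 2 * \<eta> / 2. weight xs)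
      \<le> (expect (\<lambda>xs. (l2_statistic n m xs)\<^sup>2) - (expect (l2_statistic n m))\<^sup>2) / (real m ^ 2 * \<eta> / 2)\<^sup>2"
      by (rule chebyshev) (use \<eta> m D in \<open>auto simp: expect_l2_statistic\<close>)
    also have "\<dots> \<le> (real m ^ 2 * s\<^sup>2 + 2 * real m ^ 3 * (s * dist_sq)) / (real m ^ 2 * \<eta> / 2)\<^sup>2"
      by (rule divide_right_mono[OF var]) simp
    also have "\<dots> \<le> 1 / 3" by (rule key) (use \<eta> D in auto)
    finally show ?thesis .
  qed
  show "(\<Sum>xs | xs \<in> words n (4 * m) \<and> l2_statistic n m xs < real m ^ 2 * \<eta> / 2. weight xs) \<le> 1 / 3"
    if far: "\<eta> \<le> dist_sq"
  proof -
    have le: "real m ^ 2 * \<eta> \<le> real m ^ 2 * dist_sq" using far by (intro mult_left_mono) auto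
    have "(\<Sum>xs | xs \<in> words n (4 * m) \<and> l2_statistic n m xs < real m ^ 2 * \<eta> / 2. weight xs)
      \<le> (expect (\<lambda>xs. (l2_statistic n m xs)\<^sup>2) - (expect (l2_statistic n m))\<^sup>2) / (real m ^ 2 * dist_sq / 2)\<^sup>2"
    proof (rule chebyshev)
      fix xs assume "l2_statistic n m xs < real m ^ 2 * \<eta> / 2"
      then show "real m ^ 2 * dist_sq / 2 \<le> \<bar>l2_statistic n m xs - expect (l2_statistic n m)\<bar>"
        unfolding expect_l2_statistic using le by linarith
    qed (use \<eta> m far in auto)
    also have "\<dots> \<le> (real m ^ 2 * s\<^sup>2 + 2 * real m ^ 3 * (s * dist_sq)) / (real m ^ 2 * dist_sq / 2)\<^sup>2"
      by (rule divide_right_mono[OF var]) simp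
    also have "\<dots> \<le> 1 / 3" by (rule key) (use \<eta> far in auto)
    finally show ?thesis .
  qed
qed

end

section \<open>Positive semidefinite matrices\<close>

lemma adjoint_carrier: "A \<in> carrier_mat n m \<Longrightarrow> mat_adjoint A \<in> carrier_mat m n"
  unfolding mat_adjoint_def by auto

lemma adjoint_index:
  fixes A :: "complex mat"
  shows "A \<in> carrier_mat n m \<Longrightarrow> i < m \<Longrightarrow> j < n \<Longrightarrow> mat_adjoint A $$ (i, j) = cnj (A $$ (j, i))"
  unfolding mat_adjoint_def by (auto simp: mat_of_rows_index)

lemma mult_index:
  fixes A :: "complex mat"
  assumes "A \<in> carrier_mat n m" "B \<in> carrier_mat m l" "i < n" "j < l"
  shows "(A * B) $$ (i, j) = (\<Sum>k<m. A $$ (i, k) * B $$ (k, j))"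
  using assms by (simp add: scalar_prod_def lessThan_atLeast0)

lemma mult_vec_index:
  fixes A :: "complex mat"
  assumes "A \<in> carrier_mat n m" "v \<in> carrier_vec m" "i < n"
  shows "(A *\<^sub>v v) $ i = (\<Sum>k<m. A $$ (i, k) * v $ k)"
  using assms by (simp add: scalar_prod_def lessThan_atLeast0)

lemma cscalar_prod_eq:
  fixes v w :: "complex vec"
  assumes "w \<in> carrier_vec n"
  shows "v \<bullet>c w = (\<Sum>k<n. v $ k * cnj (w $ k))"
  using assms by (simp add: scalar_prod_def lessThan_atLeast0)

lemma adjoint_mult:
  fixes A B :: "complex mat"
  assumes A: "A \<in> carrier_mat n m" and B: "B \<in> carrier_mat m l"
  shows "mat_adjoint (A * B) = mat_adjoint B * mat_adjoint A"
proof (rule eq_matI)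
  note cs = adjoint_carrier[OF A] adjoint_carrier[OF B] mult_carrier_mat[OF A B]
  fix i j assume "i < dim_row (mat_adjoint B * mat_adjoint A)" "j < dim_col (mat_adjoint B * mat_adjoint A)"
  then have ij: "i < l" "j < n" using cs by auto
  have "mat_adjoint (A * B) $$ (i, j) = (\<Sum>k<m. cnj (A $$ (j, k)) * cnj (B $$ (k, i)))"
    using mult_index[OF A B ij(2,1)] ij by (simp add: adjoint_index[OF cs(3)])
  also have "\<dots> = (\<Sum>k<m. mat_adjoint B $$ (i, k) * mat_adjoint A $$ (k, j))"
    using ij by (intro sum.cong) (auto simp: adjoint_index[OF A] adjoint_index[OF B])
  also have "\<dots> = (mat_adjoint B * mat_adjoint A) $$ (i, j)"
    by (rule mult_index[OF cs(2,1) ij, symmetric])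
  finally show "mat_adjoint (A * B) $$ (i, j) = (mat_adjoint B * mat_adjoint A) $$ (i, j)" .
qed (use adjoint_carrier[OF A] adjoint_carrier[OF B] adjoint_carrier[OF mult_carrier_mat[OF A B]] in auto)

lemma adjoint_adjoint:
  fixes A :: "complex mat"
  assumes A: "A \<in> carrier_mat n m"
  shows "mat_adjoint (mat_adjoint A) = A"
  using A adjoint_carrier[OF adjoint_carrier[OF A]]
  by (intro eq_matI) (auto simp: adjoint_index[OF adjoint_carrier[OF A]] adjoint_index[OF A])

lemma cscalar_prod_adjoint:
  fixes A :: "complex mat"
  assumes A: "A \<in> carrier_mat n m" and v: "v \<in> carrier_vec m" and w: "w \<in> carrier_vec n"
  shows "(A *\<^sub>v v) \<bullet>c w = v \<bullet>c (mat_adjoint A *\<^sub>v w)"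
proof -
  have "(A *\<^sub>v v) \<bullet>c w = (\<Sum>i<n. \<Sum>k<m. A $$ (i, k) * v $ k * cnj (w $ i))"
    using mult_vec_index[OF A v] by (simp add: cscalar_prod_eq[OF w] sum_distrib_right)
  also have "\<dots> = (\<Sum>k<m. v $ k * cnj ((mat_adjoint A *\<^sub>v w) $ k))"
    using mult_vec_index[OF adjoint_carrier[OF A] w]
    by (subst sum.swap) (simp add: sum_distrib_left adjoint_index[OF A] mult_ac)
  also have "\<dots> = v \<bullet>c (mat_adjoint A *\<^sub>v w)"
    using adjoint_carrier[OF A] w by (intro cscalar_prod_eq[symmetric]) auto
  finally show ?thesis .
qed

section \<open>Unitary diagonalization of Hermitian matrices\<close>

definition diagm :: "nat \<Rightarrow> (nat \<Rightarrow> real) \<Rightarrow> complex mat" where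
  "diagm n l = mat n n (\<lambda>(i, j). if i = j then complex_of_real (l i) else 0)"

lemma diagm_carrier[simp]: "diagm n l \<in> carrier_mat n n"
  and diagm_dim[simp]: "dim_row (diagm n l) = n" "dim_col (diagm n l) = n"
  by (simp_all add: diagm_def)

lemma diagm_index: "i < n \<Longrightarrow> j < n \<Longrightarrow> diagm n l $$ (i, j) = (if i = j then complex_of_real (l i) else 0)"
  by (simp add: diagm_def)

lemma diagm_adjoint: "mat_adjoint (diagm n l) = diagm n l"
proof (rule eq_matI)
  fix i j assume "i < dim_row (diagm n l)" "j < dim_col (diagm n l)"
  then show "mat_adjoint (diagm n l) $$ (i, j) = diagm n l $$ (i, j)"
    by (simp add: adjoint_index[OF diagm_carrier] diagm_index)
qed (use adjoint_carrier[OF diagm_carrier[of n l]] in auto)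

lemma diagm_mult: "diagm n l * diagm n l' = diagm n (\<lambda>i. l i * l' i)"
proof (rule eq_matI)
  fix i j assume "i < dim_row (diagm n (\<lambda>i. l i * l' i))" "j < dim_col (diagm n (\<lambda>i. l i * l' i))"
  then have ij: "i < n" "j < n" by (auto simp: diagm_def)
  show "(diagm n l * diagm n l') $$ (i, j) = diagm n (\<lambda>i. l i * l' i) $$ (i, j)"
    unfolding mult_index[OF diagm_carrier diagm_carrier ij]
    using ij by (simp add: diagm_def if_distrib[where f = "\<lambda>t. t * _"] cong: if_cong)
qed (auto simp: diagm_def)

text \<open>The block diagonal matrix with blocks \<open>c\<close> and \<open>V\<close>, by which a
  diagonalization of size m is lifted to size m + 1.\<close>

definition bordered :: "complex \<Rightarrow> nat \<Rightarrow> complex mat \<Rightarrow> complex mat" where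
  "bordered c m V = mat (Suc m) (Suc m)
     (\<lambda>(i, j). if i = 0 \<or> j = 0 then (if i = j then c else 0) else V $$ (i - 1, j - 1))"

lemma bordered_carrier[simp]: "bordered c m V \<in> carrier_mat (Suc m) (Suc m)"
  and bordered_dim[simp]: "dim_row (bordered c m V) = Suc m" "dim_col (bordered c m V) = Suc m"
  by (simp_all add: bordered_def)

lemma bordered_mult:
  assumes "V \<in> carrier_mat m m" "W \<in> carrier_mat m m"
  shows "bordered c m V * bordered c' m W = bordered (c * c') m (V * W)"
proof (rule eq_matI)
  fix i j assume "i < dim_row (bordered (c * c') m (V * W))" "j < dim_col (bordered (c * c') m (V * W))"
  then have ij: "i < Suc m" "j < Suc m" by (auto simp: bordered_def)
  show "(bordered c m V * bordered c' m W) $$ (i, j) = bordered (c * c') m (V * W) $$ (i, j)"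
    unfolding mult_index[OF bordered_carrier bordered_carrier ij] sum.lessThan_Suc_shift
    using ij mult_index[OF assms, of "i - 1" "j - 1"]
    by (cases i; cases j) (auto simp: bordered_def)
qed (auto simp: bordered_def)

lemma bordered_adjoint:
  assumes "V \<in> carrier_mat m m"
  shows "mat_adjoint (bordered c m V) = bordered (cnj c) m (mat_adjoint V)"
proof (rule eq_matI)
  fix i j assume "i < dim_row (bordered (cnj c) m (mat_adjoint V))"
    "j < dim_col (bordered (cnj c) m (mat_adjoint V))"
  then have ij: "i < Suc m" "j < Suc m" by auto
  show "mat_adjoint (bordered c m V) $$ (i, j) = bordered (cnj c) m (mat_adjoint V) $$ (i, j)"
    unfolding adjoint_index[OF bordered_carrier ij]
    using ij by (auto simp: bordered_def adjoint_index[OF assms])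
qed (use adjoint_carrier[OF bordered_carrier[of c m V]] in auto)

lemma bordered_one: "bordered 1 m (1\<^sub>m m) = 1\<^sub>m (Suc m)"
  by (intro eq_matI) (auto simp: bordered_def)

lemma bordered_diagm: "bordered (complex_of_real a) m (diagm m l) = diagm (Suc m) (case_nat a l)"
  by (intro eq_matI) (auto simp: bordered_def diagm_def split: nat.split)

text \<open>Complete \<open>v\<close> to a basis and orthogonalize. Gram-Schmidt leaves the first
  vector unchanged, so after normalizing the columns the first one is a multiple of
  \<open>v\<close>.\<close>

lemma unitary_with_first_column:
  fixes v :: "complex vec"
  assumes v: "v \<in> carrier_vec n" and v0: "v \<noteq> 0\<^sub>v n"
  obtains U c where "U \<in> carrier_mat n n" "mat_adjoint U * U = 1\<^sub>m n" "U * mat_adjoint U = 1\<^sub>m n"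
    "col U 0 = c \<cdot>\<^sub>v v"
proof -
  interpret cof_vec_space n "TYPE(complex)" .
  have n: "n > 0" using v v0 by (cases n) auto
  define b where "b = basis_completion v"
  define ws where "ws = gram_schmidt n b"
  from basis_completion[OF v v0, folded b_def]
  have dist_b: "distinct b" and indep: "\<not> lin_dep (set b)" and b: "set b \<subseteq> carrier_vec n"
    and hdb: "hd b = v" and len_b: "length b = n" by auto
  from hdb len_b n obtain vs where bv: "b = v # vs" by (cases b) auto
  from gram_schmidt_result[OF b dist_b indep refl, folded ws_def]
  have ws: "set ws \<subseteq> carrier_vec n" "corthogonal ws" "length ws = n"
    by (auto simp: len_b)
  have "hd ws = v" using gram_schmidt_hd[OF v, of vs, folded bv] by (simp add: ws_def)
  then have ws0: "ws ! 0 = v" using ws n by (cases ws) auto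
  have wsc: "ws ! i \<in> carrier_vec n" if "i < n" for i
    using ws that by (auto intro: subsetD)
  define N where "N i = sqrt (Re ((ws ! i) \<bullet>c (ws ! i)))" for i
  have orth: "(ws ! i) \<bullet>c (ws ! j) = (if i = j then complex_of_real ((N i)\<^sup>2) else 0)"
    and Npos: "N i > 0" if "i < n" "j < n" for i j
  proof -
    have "0 \<le> (ws ! i) \<bullet>c (ws ! i)" by (rule conjugate_square_ge_0_vec)
    moreover have "(ws ! i) \<bullet>c (ws ! i) \<noteq> 0"
      using corthogonalD[OF ws(2), of i i] that ws by auto
    ultimately have "Im ((ws ! i) \<bullet>c (ws ! i)) = 0" "Re ((ws ! i) \<bullet>c (ws ! i)) > 0"
      by (auto simp: less_eq_complex_def complex_eq_iff)
    then show "(ws ! i) \<bullet>c (ws ! j) = (if i = j then complex_of_real ((N i)\<^sup>2) else 0)" "N i > 0"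
      using corthogonalD[OF ws(2), of i j] that ws by (auto simp: N_def complex_eq_iff)
  qed
  define U where "U = mat n n (\<lambda>(i, j). (ws ! j) $ i / complex_of_real (N j))"
  have U: "U \<in> carrier_mat n n" by (simp add: U_def)
  have UU: "mat_adjoint U * U = 1\<^sub>m n"
  proof (rule eq_matI)
    fix i j assume "i < dim_row (1\<^sub>m n)" "j < dim_col (1\<^sub>m n)"
    then have ij: "i < n" "j < n" by auto
    have "(mat_adjoint U * U) $$ (i, j)
        = (\<Sum>k<n. (ws ! j) $ k * cnj ((ws ! i) $ k) / (complex_of_real (N i) * complex_of_real (N j)))"
      unfolding mult_index[OF adjoint_carrier[OF U] U ij]
      using ij by (intro sum.cong refl) (simp add: adjoint_index[OF U], simp add: U_def)
    also have "\<dots> = (ws ! j) \<bullet>c (ws ! i) / (complex_of_real (N i) * complex_of_real (N j))"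
      by (simp add: cscalar_prod_eq[OF wsc[OF ij(1)]] sum_divide_distrib)
    also have "\<dots> = 1\<^sub>m n $$ (i, j)"
      using ij Npos[OF ij] by (cases "i = j") (simp_all add: orth power2_eq_square)
    finally show "(mat_adjoint U * U) $$ (i, j) = 1\<^sub>m n $$ (i, j)" .
  qed (use U adjoint_carrier[OF U] in auto)
  moreover have "U * mat_adjoint U = 1\<^sub>m n"
    by (rule mat_mult_left_right_inverse[OF adjoint_carrier[OF U] U UU])
  moreover have "col U 0 = (1 / complex_of_real (N 0)) \<cdot>\<^sub>v v"
    using n v by (intro eq_vecI) (auto simp: U_def ws0)
  ultimately show ?thesis using that U by blast
qed

text \<open>Deflation: conjugation by a unitary whose first column is an eigenvector clears the
  first column below the diagonal. Hermiticity then clears the first row and makes the eigenvalue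
  real, and the remaining block is Hermitian of smaller size.\<close>

theorem hermitian_diagonalization:
  assumes "A \<in> carrier_mat n n" "mat_adjoint A = (A :: complex mat)"
  shows "\<exists>U l. U \<in> carrier_mat n n \<and> mat_adjoint U * U = 1\<^sub>m n \<and> U * mat_adjoint U = 1\<^sub>m n
    \<and> A = U * diagm n l * mat_adjoint U"
  using assms
proof (induction n arbitrary: A)
  case 0
  then show ?case
    by (intro exI[of _ "1\<^sub>m 0"] exI[of _ "\<lambda>_. 0"]) (auto simp: mat_adjoint_def)
next
  case (Suc m)
  let ?n = "Suc m"
  note A = Suc.prems(1) and herm = Suc.prems(2)
  obtain e where "eigenvalue A e"
    using spectrum_non_empty[OF A] by (auto simp: spectrum_def)
  then obtain v where v: "v \<in> carrier_vec ?n" "v \<noteq> 0\<^sub>v ?n" "A *\<^sub>v v = e \<cdot>\<^sub>v v"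
    using A by (auto simp: eigenvalue_def eigenvector_def)
  obtain U c where U: "U \<in> carrier_mat ?n ?n" and UU: "mat_adjoint U * U = 1\<^sub>m ?n"
    and UU': "U * mat_adjoint U = 1\<^sub>m ?n" and col: "col U 0 = c \<cdot>\<^sub>v v"
    using unitary_with_first_column[OF v(1,2)] by metis
  note U' = adjoint_carrier[OF U]
  define A' where "A' = mat_adjoint U * (A * U)"
  have A': "A' \<in> carrier_mat ?n ?n" using A U U' by (simp add: A'_def)
  have "mat_adjoint A' = mat_adjoint (A * U) * mat_adjoint (mat_adjoint U)"
    unfolding A'_def using A U U' by (intro adjoint_mult) auto
  also have "\<dots> = mat_adjoint U * A * U"
    using A U by (simp add: adjoint_mult[OF A U] herm adjoint_adjoint[OF U])
  also have "\<dots> = A'" unfolding A'_def using A U U' by (intro assoc_mult_mat) auto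
  finally have herm': "mat_adjoint A' = A'" .
  have col0: "A' $$ (i, 0) = (if i = 0 then e else 0)" if i: "i < ?n" for i
  proof -
    have AU: "(A * U) $$ (k, 0) = e * U $$ (k, 0)" if k: "k < ?n" for k
    proof -
      have "col (A * U) 0 = A *\<^sub>v (c \<cdot>\<^sub>v v)"
        unfolding col[symmetric] by (rule col_mult2[OF A U]) simp
      also have "\<dots> = e \<cdot>\<^sub>v col U 0"
        using A v col by (simp add: mult_mat_vec[OF A v(1)] smult_smult_assoc mult.commute)
      finally have "col (A * U) 0 $ k = (e \<cdot>\<^sub>v col U 0) $ k" by simp
      then show ?thesis using A U k by simp
    qed
    have "A' $$ (i, 0) = (\<Sum>k<?n. mat_adjoint U $$ (i, k) * (A * U) $$ (k, 0))"
      unfolding A'_def using A U U' i by (intro mult_index) auto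
    also have "\<dots> = e * (\<Sum>k<?n. mat_adjoint U $$ (i, k) * U $$ (k, 0))"
      unfolding sum_distrib_left by (intro sum.cong) (auto simp: AU)
    also have "(\<Sum>k<?n. mat_adjoint U $$ (i, k) * U $$ (k, 0)) = (mat_adjoint U * U) $$ (i, 0)"
      using U U' i by (intro mult_index[symmetric]) auto
    finally show ?thesis using i by (simp add: UU)
  qed
  have A'_cnj: "A' $$ (i, j) = cnj (A' $$ (j, i))" if "i < ?n" "j < ?n" for i j
    using adjoint_index[OF A' that] herm' by simp
  have "e = cnj e" using A'_cnj[of 0 0] col0[of 0] by simp
  then obtain a where a: "e = complex_of_real a"
    by (metis Reals_cases Reals_cnj_iff)
  define A3 where "A3 = mat m m (\<lambda>(i, j). A' $$ (Suc i, Suc j))"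
  have A3: "A3 \<in> carrier_mat m m" by (simp add: A3_def)
  have "mat_adjoint A3 = A3"
  proof (rule eq_matI)
    fix i j assume "i < dim_row A3" "j < dim_col A3"
    then have "i < m" "j < m" using A3 by auto
    then show "mat_adjoint A3 $$ (i, j) = A3 $$ (i, j)"
      using A'_cnj[of "Suc i" "Suc j"] by (simp add: adjoint_index[OF A3]) (simp add: A3_def)
  qed (use A3 adjoint_carrier[OF A3] in auto)
  from Suc.IH[OF A3 this] obtain V l where V: "V \<in> carrier_mat m m"
    and VV: "mat_adjoint V * V = 1\<^sub>m m" "V * mat_adjoint V = 1\<^sub>m m"
    and A3_eq: "A3 = V * diagm m l * mat_adjoint V" by blast
  note V' = adjoint_carrier[OF V]
  have A'_eq: "A' = bordered e m A3"
  proof (rule eq_matI)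
    fix i j assume "i < dim_row (bordered e m A3)" "j < dim_col (bordered e m A3)"
    then have "i < ?n" "j < ?n" by (auto simp: bordered_def)
    then show "A' $$ (i, j) = bordered e m A3 $$ (i, j)"
      using col0[of i] col0[of j] A'_cnj[of 0 j] \<open>e = cnj e\<close>
      by (auto simp: bordered_def A3_def)
  qed (use A' in \<open>auto simp: bordered_def\<close>)
  define W where "W = bordered 1 m V"
  define D where "D = diagm ?n (case_nat a l)"
  have W: "W \<in> carrier_mat ?n ?n" and D: "D \<in> carrier_mat ?n ?n" by (simp_all add: W_def D_def)
  have W_adj: "mat_adjoint W = bordered 1 m (mat_adjoint V)"
    by (simp add: W_def bordered_adjoint[OF V])
  note W' = adjoint_carrier[OF W]
  have WW: "mat_adjoint W * W = 1\<^sub>m ?n" "W * mat_adjoint W = 1\<^sub>m ?n"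
    unfolding W_adj by (simp_all add: W_def bordered_mult V V' VV bordered_one)
  have A'_D: "A' = W * D * mat_adjoint W"
    unfolding W_adj D_def bordered_diagm[symmetric] A'_eq A3_eq a
    by (simp add: W_def bordered_mult V V' mult_carrier_mat[OF V diagm_carrier])
  define X where "X = U * W"
  have X: "X \<in> carrier_mat ?n ?n" using U W by (simp add: X_def)
  have X_adj: "mat_adjoint X = mat_adjoint W * mat_adjoint U"
    unfolding X_def by (rule adjoint_mult[OF U W])
  have "mat_adjoint X * X = mat_adjoint W * (mat_adjoint U * U) * W"
    unfolding X_adj unfolding X_def using U U' W W' by (simp add: assoc_mult_mat[of _ ?n ?n _ ?n _ ?n])
  then have X1: "mat_adjoint X * X = 1\<^sub>m ?n" using W W' by (simp add: UU WW)
  have X2: "X * mat_adjoint X = 1\<^sub>m ?n"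
    by (rule mat_mult_left_right_inverse[OF adjoint_carrier[OF X] X X1])
  have "A = (U * mat_adjoint U) * A * (U * mat_adjoint U)"
    using A by (simp add: UU')
  also have "\<dots> = U * A' * mat_adjoint U"
    unfolding A'_def using A U U' by (simp add: assoc_mult_mat[of _ ?n ?n _ ?n _ ?n])
  also have "\<dots> = X * D * mat_adjoint X"
    unfolding A'_D X_adj unfolding X_def using D U U' W W' by (simp add: assoc_mult_mat[of _ ?n ?n _ ?n _ ?n])
  finally show ?case using X X1 X2 unfolding D_def by blast
qed

section \<open>Positive semidefinite square roots\<close>

lemma psd_carrier: "psd n A \<Longrightarrow> A \<in> carrier_mat n n"
  and psd_adjoint: "psd n A \<Longrightarrow> mat_adjoint A = A"
  and psd_ge_0: "psd n A \<Longrightarrow> v \<in> carrier_vec n \<Longrightarrow> 0 \<le> (A *\<^sub>v v) \<bullet>c v"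
  by (auto simp: psd_def)

lemma mat_adjoint_mult_self_psd:
  fixes A :: "complex mat"
  assumes A: "A \<in> carrier_mat n n"
  shows "psd n (mat_adjoint A * A)"
  unfolding psd_def
proof (intro conjI ballI)
  note A' = adjoint_carrier[OF A]
  show "mat_adjoint A * A \<in> carrier_mat n n" using A A' by auto
  show "mat_adjoint (mat_adjoint A * A) = mat_adjoint A * A"
    by (simp add: adjoint_mult[OF A' A] adjoint_adjoint[OF A])
  fix v :: "complex vec" assume v: "v \<in> carrier_vec n"
  have "(mat_adjoint A * A *\<^sub>v v) \<bullet>c v = (mat_adjoint A *\<^sub>v (A *\<^sub>v v)) \<bullet>c v"
    using A A' v by simp
  also have "\<dots> = (A *\<^sub>v v) \<bullet>c (A *\<^sub>v v)"
    using cscalar_prod_adjoint[OF A', of "A *\<^sub>v v" v] A v by (simp add: adjoint_adjoint[OF A])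
  also have "\<dots> \<ge> 0" by (rule conjugate_square_ge_0_vec)
  finally show "0 \<le> (mat_adjoint A * A *\<^sub>v v) \<bullet>c v" .
qed

lemma diagm_mult_vec_inner:
  fixes v :: "complex vec"
  assumes v: "v \<in> carrier_vec n"
  shows "(diagm n l *\<^sub>v v) \<bullet>c v = (\<Sum>k<n. complex_of_real (l k * (cmod (v $ k))\<^sup>2))"
proof -
  have "(diagm n l *\<^sub>v v) $ k = complex_of_real (l k) * v $ k" if "k < n" for k
    unfolding mult_vec_index[OF diagm_carrier v that]
    using that by (simp add: diagm_index if_distrib[where f = "\<lambda>t. t * _"] cong: if_cong)
  then show ?thesis
    by (simp add: cscalar_prod_eq[OF v] complex_norm_square mult.assoc del: of_real_power)
qed

lemma ex_psd_root:
  assumes psd: "psd n A"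
  shows "\<exists>B. psd n B \<and> B * B = A"
proof -
  note A = psd_carrier[OF psd]
  obtain U l where U: "U \<in> carrier_mat n n" and UU: "mat_adjoint U * U = 1\<^sub>m n"
    and A_eq: "A = U * diagm n l * mat_adjoint U"
    using hermitian_diagonalization[OF A psd_adjoint[OF psd]] by blast
  note U' = adjoint_carrier[OF U]
  \<comment> \<open>The quadratic form in eigencoordinates, for an arbitrary diagonal
    \<open>f\<close>. With \<open>f = l\<close> and \<open>v\<close> a column of \<open>U\<close> it
    shows that the eigenvalues are nonnegative; with their square roots it shows that the root is
    positive semidefinite.\<close>
  have inner: "(U * diagm n f * mat_adjoint U *\<^sub>v v) \<bullet>c v
      = (\<Sum>k<n. complex_of_real (f k * (cmod ((mat_adjoint U *\<^sub>v v) $ k))\<^sup>2))"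
    if v: "v \<in> carrier_vec n" for v f
  proof -
    have "(U * diagm n f * mat_adjoint U *\<^sub>v v) \<bullet>c v = (U *\<^sub>v (diagm n f *\<^sub>v (mat_adjoint U *\<^sub>v v))) \<bullet>c v"
      using U U' v diagm_carrier[of n f] by (simp add: assoc_mult_mat_vec[of _ n n _ n] mult_carrier_mat[of U n n])
    also have "\<dots> = (diagm n f *\<^sub>v (mat_adjoint U *\<^sub>v v)) \<bullet>c (mat_adjoint U *\<^sub>v v)"
      by (rule cscalar_prod_adjoint[OF U _ v]) (rule mult_mat_vec_carrier[OF diagm_carrier], use U' v in auto)
    also have "\<dots> = (\<Sum>k<n. complex_of_real (f k * (cmod ((mat_adjoint U *\<^sub>v v) $ k))\<^sup>2))"
      by (rule diagm_mult_vec_inner) (use U' v in auto)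
    finally show ?thesis .
  qed
  have l: "0 \<le> l i" if i: "i < n" for i
  proof -
    define v where "v = U *\<^sub>v unit_vec n i"
    have v: "v \<in> carrier_vec n" using U by (simp add: v_def)
    have "mat_adjoint U *\<^sub>v v = unit_vec n i"
      unfolding v_def using U U' by (subst assoc_mult_mat_vec[symmetric, of _ n n _ n]) (auto simp: UU)
    then have "(A *\<^sub>v v) \<bullet>c v = (\<Sum>k<n. complex_of_real (l k * (cmod (unit_vec n i $ k))\<^sup>2))"
      unfolding A_eq inner[OF v] by simp
    also have "\<dots> = (\<Sum>k<n. if k = i then complex_of_real (l k) else 0)"
      using i by (intro sum.cong) auto
    also have "\<dots> = complex_of_real (l i)" using i by simp
    finally show ?thesis using psd_ge_0[OF psd v] by (simp add: less_eq_complex_def)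
  qed
  define B where "B = U * diagm n (\<lambda>i. sqrt (l i)) * mat_adjoint U"
  have UD: "U * diagm n f \<in> carrier_mat n n" for f using U by simp
  have B: "B \<in> carrier_mat n n" unfolding B_def by (rule mult_carrier_mat[OF UD U'])
  have "mat_adjoint B = U * (diagm n (\<lambda>i. sqrt (l i)) * mat_adjoint U)"
    unfolding B_def
    by (simp add: adjoint_mult[OF UD U'] adjoint_mult[OF U diagm_carrier] adjoint_adjoint[OF U] diagm_adjoint)
  also have "\<dots> = B" unfolding B_def using U U' by (simp add: assoc_mult_mat[of _ n n _ n _ n] mult_carrier_mat[of _ n n _ n])
  finally have "mat_adjoint B = B" .
  moreover have "0 \<le> (B *\<^sub>v v) \<bullet>c v" if "v \<in> carrier_vec n" for v
    unfolding B_def inner[OF that] using l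
    by (auto simp: less_eq_complex_def intro!: sum_nonneg)
  ultimately have "psd n B" using B by (auto simp: psd_def)
  moreover have "B * B = A"
  proof -
    have "B * B = U * diagm n (\<lambda>i. sqrt (l i)) * (mat_adjoint U * U) * diagm n (\<lambda>i. sqrt (l i)) * mat_adjoint U"
      unfolding B_def using U U' by (simp add: assoc_mult_mat[of _ n n _ n _ n] mult_carrier_mat[of _ n n _ n])
    also have "\<dots> = U * (diagm n (\<lambda>i. sqrt (l i)) * diagm n (\<lambda>i. sqrt (l i))) * mat_adjoint U"
      unfolding UU using U U' by (simp add: assoc_mult_mat[of _ n n _ n _ n] mult_carrier_mat[of _ n n _ n])
    also have "diagm n (\<lambda>i. sqrt (l i)) * diagm n (\<lambda>i. sqrt (l i)) = diagm n l"
      unfolding diagm_mult using l by (intro eq_matI) (auto simp: diagm_index)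
    finally show ?thesis using A_eq by simp
  qed
  ultimately show ?thesis by blast
qed

text \<open>With B = S S for a Hermitian \<open>S\<close>, the form is the squared norm of S v;
  hence S v vanishes, and so does B v.\<close>

lemma psd_kernel:
  assumes psd: "psd n B" and v: "v \<in> carrier_vec n" and 0: "(B *\<^sub>v v) \<bullet>c v = 0"
  shows "B *\<^sub>v v = 0\<^sub>v n"
proof -
  obtain S where S: "psd n S" and SS: "S * S = B" using ex_psd_root[OF psd] by blast
  note Sc = psd_carrier[OF S]
  have "(B *\<^sub>v v) \<bullet>c v = (S *\<^sub>v (S *\<^sub>v v)) \<bullet>c v"
    unfolding SS[symmetric] using Sc v by simp
  also have "\<dots> = (S *\<^sub>v v) \<bullet>c (S *\<^sub>v v)"
    using cscalar_prod_adjoint[OF Sc, of "S *\<^sub>v v" v] Sc v by (simp add: psd_adjoint[OF S])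
  finally have "S *\<^sub>v v = 0\<^sub>v n"
    using 0 Sc v conjugate_square_eq_0_vec[of "S *\<^sub>v v" n] by simp
  then have "S *\<^sub>v (S *\<^sub>v v) = 0\<^sub>v n" using Sc by (auto simp: mult_mat_vec_def scalar_prod_def)
  then show ?thesis unfolding SS[symmetric] using Sc v by simp
qed

lemma trace_eq: "A \<in> carrier_mat n m \<Longrightarrow> trace A = (\<Sum>i<n. A $$ (i, i))"
  by (auto simp: trace_def)

lemma trace_mult_comm:
  assumes A: "A \<in> carrier_mat n m" and B: "B \<in> carrier_mat m n"
  shows "trace (A * B) = trace (B * A)"
proof -
  have "trace (A * B) = (\<Sum>i<n. \<Sum>k<m. A $$ (i, k) * B $$ (k, i))"
    using trace_eq[OF mult_carrier_mat[OF A B]] mult_index[OF A B] by simp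
  also have "\<dots> = (\<Sum>k<m. \<Sum>i<n. B $$ (k, i) * A $$ (i, k))"
    by (subst sum.swap) (simp add: mult.commute)
  also have "\<dots> = trace (B * A)"
    using trace_eq[OF mult_carrier_mat[OF B A]] mult_index[OF B A] by simp
  finally show ?thesis .
qed

lemma trace_add:
  "A \<in> carrier_mat n n \<Longrightarrow> B \<in> carrier_mat n n \<Longrightarrow> trace (A + B) = trace A + trace B"
  by (simp add: trace_def sum.distrib)

text \<open>With \<open>D = B - C\<close> one has \<open>B * D + D * C = 0\<close>; multiplying by \<open>D\<close> and taking traces, all the
  nonnegative numbers \<open>\<langle>B d, d\<rangle>\<close> and \<open>\<langle>C d, d\<rangle>\<close>, for \<open>d\<close> a column of \<open>D\<close>, vanish.\<close>

lemma psd_root_unique: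
  assumes B: "psd n B" and C: "psd n C" and eq: "B * B = C * C"
  shows "B = C"
proof -
  note Bc = psd_carrier[OF B] and Cc = psd_carrier[OF C]
  define D where "D = B - C"
  have D: "D \<in> carrier_mat n n" unfolding D_def by (rule minus_carrier_mat[OF Cc])
  have D_adj: "mat_adjoint D = D"
  proof (rule eq_matI)
    fix i j assume "i < dim_row D" "j < dim_col D"
    then have ij: "i < n" "j < n" using D by auto
    have "B $$ (i, j) = cnj (B $$ (j, i))" "C $$ (i, j) = cnj (C $$ (j, i))"
      using adjoint_index[OF Bc ij] adjoint_index[OF Cc ij] psd_adjoint[OF B] psd_adjoint[OF C] by auto
    then show "mat_adjoint D $$ (i, j) = D $$ (i, j)"
      unfolding adjoint_index[OF D ij] using ij Bc Cc by (simp add: D_def)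
  qed (use D adjoint_carrier[OF D] in auto)
  have BD: "B * D \<in> carrier_mat n n" and DC: "D * C \<in> carrier_mat n n"
    and CD: "C * D \<in> carrier_mat n n" using Bc Cc D by auto
  have zero: "B * D + D * C = 0\<^sub>m n n"
  proof -
    have "B * D = B * B - B * C" "D * C = B * C - C * C"
      unfolding D_def using Bc Cc by (simp_all add: mult_minus_distrib_mat minus_mult_distrib_mat)
    then show ?thesis using Bc Cc eq by (intro eq_matI) auto
  qed
  have tr: "trace (D * (M * D)) = (\<Sum>i<n. (M *\<^sub>v col D i) \<bullet>c col D i)" if M: "M \<in> carrier_mat n n" for M
  proof -
    have MD: "M * D \<in> carrier_mat n n" using M D by simp
    have "(D * (M * D)) $$ (i, i) = (M *\<^sub>v col D i) \<bullet>c col D i" if i: "i < n" for i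
    proof -
      have c: "col D i \<in> carrier_vec n" using D by (metis carrier_matD(1) col_dim)
      have "(D * (M * D)) $$ (i, i) = (\<Sum>k<n. mat_adjoint D $$ (i, k) * (M * D) $$ (k, i))"
        unfolding D_adj by (rule mult_index[OF D MD i i])
      also have "\<dots> = (\<Sum>k<n. (M *\<^sub>v col D i) $ k * cnj (col D i $ k))"
        using i D M by (intro sum.cong refl) (simp add: adjoint_index[OF D])
      finally show ?thesis by (simp add: cscalar_prod_eq[OF c])
    qed
    then show ?thesis using trace_eq[of "D * (M * D)" n n] D MD by simp
  qed
  have nn: "0 \<le> (\<Sum>i<n. (M *\<^sub>v col D i) \<bullet>c col D i)" if "psd n M" for M
    by (intro sum_nonneg psd_ge_0[OF that]) (metis D carrier_matD(1) col_dim)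
  have "D * (B * D) + D * (D * C) = D * (B * D + D * C)"
    by (rule mult_add_distrib_mat[symmetric, OF D BD DC])
  also have "\<dots> = 0\<^sub>m n n" unfolding zero using D by simp
  finally have "trace (D * (B * D)) + trace (D * (D * C)) = 0"
    using trace_add[of "D * (B * D)" n "D * (D * C)"] D BD DC by (simp add: trace_def)
  also have "trace (D * (D * C)) = trace (D * (C * D))"
    using trace_mult_comm[OF D DC] D Cc by simp
  finally have sum0: "(\<Sum>i<n. (B *\<^sub>v col D i) \<bullet>c col D i) + (\<Sum>i<n. (C *\<^sub>v col D i) \<bullet>c col D i) = 0"
    unfolding tr[OF Bc] tr[OF Cc] .
  then have z: "(\<Sum>i<n. (B *\<^sub>v col D i) \<bullet>c col D i) = 0" "(\<Sum>i<n. (C *\<^sub>v col D i) \<bullet>c col D i) = 0"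
    using nn[OF B] nn[OF C] by (simp_all add: add_nonneg_eq_0_iff)
  have vanish: "(M *\<^sub>v col D i) \<bullet>c col D i = 0"
    if "psd n M" "(\<Sum>i<n. (M *\<^sub>v col D i) \<bullet>c col D i) = 0" "i < n" for M i
  proof -
    have "0 \<le> (M *\<^sub>v col D i) \<bullet>c col D i" for i
      by (rule psd_ge_0[OF that(1)]) (metis D carrier_matD(1) col_dim)
    then show ?thesis
      using sum_nonneg_eq_0_iff[of "{..<n}" "\<lambda>i. (M *\<^sub>v col D i) \<bullet>c col D i"] that by simp
  qed
  note each = vanish[OF B z(1)] vanish[OF C z(2)]
  \<comment> \<open>Both \<open>B\<close> and \<open>C\<close> annihilate the columns of
    \<open>D\<close>, so D D = 0. As \<open>D\<close> is Hermitian, the diagonal entries of D D are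
    the squared norms of its columns.\<close>
  have col0: "col D i = 0\<^sub>v n" if i: "i < n" for i
  proof -
    have c: "col D i \<in> carrier_vec n" using D by (metis carrier_matD(1) col_dim)
    have "D *\<^sub>v col D i = B *\<^sub>v col D i - C *\<^sub>v col D i"
      using minus_mult_distrib_mat_vec[OF Bc Cc c] by (simp add: D_def)
    also have "\<dots> = 0\<^sub>v n"
      using psd_kernel[OF B c each(1)[OF i]] psd_kernel[OF C c each(2)[OF i]] by simp
    finally have "D *\<^sub>v col D i = 0\<^sub>v n" .
    moreover have "(D * D) $$ (i, i) = (D *\<^sub>v col D i) $ i" using D i by simp
    ultimately have "(D * D) $$ (i, i) = 0" using i by simp
    moreover have "(D * D) $$ (i, i) = (\<Sum>k<n. mat_adjoint D $$ (i, k) * D $$ (k, i))"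
      unfolding D_adj by (rule mult_index[OF D D i i])
    moreover have "\<dots> = col D i \<bullet>c col D i"
      unfolding cscalar_prod_eq[OF c] using D i
      by (intro sum.cong refl) (simp add: adjoint_index[OF D])
    ultimately show ?thesis using c by simp
  qed
  show "B = C"
  proof (rule eq_matI)
    fix i j assume ij: "i < dim_row C" "j < dim_col C"
    then have "col D j $ i = 0" using col0[of j] Cc by simp
    then show "B $$ (i, j) = C $$ (i, j)" using ij Bc Cc by (simp add: D_def)
  qed (use Bc Cc in auto)
qed

lemma psd_sqrt:
  assumes "psd n A"
  shows "psd n (psd_sqrt A)" "psd_sqrt A * psd_sqrt A = A"
proof -
  have n: "dim_row A = n" using psd_carrier[OF assms] by auto
  have "\<exists>!B. psd n B \<and> B * B = A"
    using ex_psd_root[OF assms] psd_root_unique by blast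
  from theI'[OF this] show "psd n (psd_sqrt A)" "psd_sqrt A * psd_sqrt A = A"
    unfolding psd_sqrt_def n by auto
qed

section \<open>Frobenius norm, trace norm and purity\<close>

definition frobenius_sq :: "nat \<Rightarrow> complex mat \<Rightarrow> real" where
  "frobenius_sq n A = (\<Sum>i<n. \<Sum>j<n. (cmod (A $$ (i, j)))\<^sup>2)"

lemma trace_adjoint_mult_self:
  assumes A: "A \<in> carrier_mat n n"
  shows "trace (mat_adjoint A * A) = complex_of_real (frobenius_sq n A)"
proof -
  note A' = adjoint_carrier[OF A]
  have "trace (mat_adjoint A * A) = (\<Sum>i<n. \<Sum>k<n. mat_adjoint A $$ (i, k) * A $$ (k, i))"
    using trace_eq[OF mult_carrier_mat[OF A' A]] mult_index[OF A' A] by simp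
  also have "\<dots> = (\<Sum>i<n. \<Sum>k<n. complex_of_real ((cmod (A $$ (k, i)))\<^sup>2))"
    by (intro sum.cong refl) (simp add: adjoint_index[OF A] complex_norm_square mult.commute del: of_real_power)
  finally show ?thesis
    by (subst (asm) sum.swap) (simp add: frobenius_sq_def)
qed

text \<open>The trace norm is the sum of the n diagonal entries of the root \<open>S\<close>, so
  Cauchy-Schwarz costs a factor n; and \<open>S\<close> has the same Frobenius norm as
  \<open>A\<close> because S S equals the adjoint of \<open>A\<close> times
  \<open>A\<close>.\<close>

lemma trace_norm_sq_le:
  assumes A: "A \<in> carrier_mat n n"
  shows "(trace_norm A)\<^sup>2 \<le> real n * frobenius_sq n A"
proof -
  define S where "S = psd_sqrt (mat_adjoint A * A)"
  note S = psd_sqrt[OF mat_adjoint_mult_self_psd[OF A], folded S_def]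
  note Sc = psd_carrier[OF S(1)]
  have fro: "frobenius_sq n S = frobenius_sq n A"
    using trace_adjoint_mult_self[OF Sc] trace_adjoint_mult_self[OF A] S
    by (simp add: psd_adjoint[OF S(1)])
  have "trace_norm A = (\<Sum>i<n. 1 * Re (S $$ (i, i)))"
    unfolding trace_norm_def S_def[symmetric] by (simp add: trace_eq[OF Sc])
  also have "\<dots>\<^sup>2 \<le> (\<Sum>i<n. 1\<^sup>2) * (\<Sum>i<n. (Re (S $$ (i, i)))\<^sup>2)"
    by (rule Cauchy_Schwarz_sum)
  also have "\<dots> \<le> real n * frobenius_sq n S"
  proof -
    have "(Re (S $$ (i, i)))\<^sup>2 \<le> (\<Sum>j<n. (cmod (S $$ (i, j)))\<^sup>2)" if "i < n" for i
    proof -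
      have "(Re (S $$ (i, i)))\<^sup>2 \<le> (cmod (S $$ (i, i)))\<^sup>2"
        by (simp add: cmod_power2)
      also have "\<dots> \<le> (\<Sum>j<n. (cmod (S $$ (i, j)))\<^sup>2)"
        using that by (intro member_le_sum) auto
      finally show ?thesis .
    qed
    then show ?thesis unfolding frobenius_sq_def by (auto intro!: mult_left_mono sum_mono)
  qed
  finally show ?thesis unfolding fro .
qed

text \<open>The entries of \<open>\<rho>\<close> are inner products of rows of its root, so
  Cauchy-Schwarz bounds |\<rho>_ij|^2 by \<rho>_ii \<rho>_jj, and these products sum to the squared
  trace.\<close>

lemma frobenius_sq_density_le:
  assumes \<rho>: "\<rho> \<in> density_operators n"
  shows "frobenius_sq n \<rho> \<le> 1"
proof -
  have psd: "psd n \<rho>" and tr: "trace \<rho> = 1" using \<rho> by (auto simp: density_operators_def)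
  define S where "S = psd_sqrt \<rho>"
  note S = psd_sqrt[OF psd, folded S_def]
  note Sc = psd_carrier[OF S(1)]
  define r where "r i = (\<Sum>k<n. (cmod (S $$ (i, k)))\<^sup>2)" for i
  have S_cnj: "S $$ (k, j) = cnj (S $$ (j, k))" if "k < n" "j < n" for k j
    using adjoint_index[OF Sc that] psd_adjoint[OF S(1)] by simp
  have ent: "\<rho> $$ (i, j) = (\<Sum>k<n. S $$ (i, k) * cnj (S $$ (j, k)))" if "i < n" "j < n" for i j
    unfolding S(2)[symmetric] mult_index[OF Sc Sc that] using that
    by (intro sum.cong refl arg_cong2[where f = "(*)"] S_cnj) auto
  have "\<rho> $$ (i, i) = complex_of_real (r i)" if "i < n" for i
    unfolding ent[OF that that] r_def by (simp add: complex_norm_square del: of_real_power)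
  then have "complex_of_real (\<Sum>i<n. r i) = 1"
    using tr by (simp add: trace_eq[OF psd_carrier[OF psd]])
  then have r1: "(\<Sum>i<n. r i) = 1" by (metis of_real_eq_1_iff)
  have "(cmod (\<rho> $$ (i, j)))\<^sup>2 \<le> r i * r j" if "i < n" "j < n" for i j
  proof -
    have "cmod (\<rho> $$ (i, j)) \<le> (\<Sum>k<n. cmod (S $$ (i, k)) * cmod (S $$ (j, k)))"
      unfolding ent[OF that] by (rule sum_norm_le) (simp add: norm_mult)
    then have "(cmod (\<rho> $$ (i, j)))\<^sup>2 \<le> (\<Sum>k<n. cmod (S $$ (i, k)) * cmod (S $$ (j, k)))\<^sup>2"
      by (intro power_mono) auto
    also have "\<dots> \<le> r i * r j" unfolding r_def by (rule Cauchy_Schwarz_sum)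
    finally show ?thesis .
  qed
  then have "frobenius_sq n \<rho> \<le> (\<Sum>i<n. \<Sum>j<n. r i * r j)"
    unfolding frobenius_sq_def by (auto intro!: sum_mono)
  also have "\<dots> = 1" by (simp add: r1 flip: sum_product)
  finally show ?thesis .
qed

section \<open>Product measurements by rank-one effects\<close>

lemma sum_div_mod:
  fixes f :: "nat \<Rightarrow> nat \<Rightarrow> 'a :: comm_monoid_add"
  shows "(\<Sum>i<a * b. f (i div b) (i mod b)) = (\<Sum>i<a. \<Sum>j<b. f i j)"
proof -
  have "(\<Sum>i<a * b. f (i div b) (i mod b)) = (\<Sum>(i, j)\<in>{..<a} \<times> {..<b}. f i j)"
  proof (rule sum.reindex_bij_witness[where i = "\<lambda>(i, j). i * b + j" and j = "\<lambda>i. (i div b, i mod b)"])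
    fix x assume x: "x \<in> {..<a} \<times> {..<b}"
    then have "fst x * b + snd x < (fst x + 1) * b" "(fst x + 1) * b \<le> a * b"
      using mult_le_mono1[of "fst x + 1" a b] by auto
    then show "(\<lambda>(i, j). i * b + j) x \<in> {..<a * b}" by (simp add: case_prod_unfold)
  next
    fix i assume i: "i \<in> {..<a * b}"
    then have "b > 0" by (cases b) auto
    then show "(i div b, i mod b) \<in> {..<a} \<times> {..<b}"
      using i by (simp add: less_mult_imp_div_less)
  qed (auto simp: div_mult_self3)
  then show ?thesis by (simp add: sum.cartesian_product)
qed

lemma kron_carrier:
  "A \<in> carrier_mat a a' \<Longrightarrow> B \<in> carrier_mat b b' \<Longrightarrow> kron A B \<in> carrier_mat (a * b) (a' * b')"
  by (auto simp: kron_def)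

lemma trace_mult_eq:
  assumes "A \<in> carrier_mat n m" "B \<in> carrier_mat m n"
  shows "trace (A * B) = (\<Sum>i<n. \<Sum>k<m. A $$ (i, k) * B $$ (k, i))"
  using assms mult_index[OF assms] by (simp add: trace_def)

lemma trace_kron_mult:
  assumes A: "A \<in> carrier_mat a a" "A' \<in> carrier_mat a a" and B: "B \<in> carrier_mat b b" "B' \<in> carrier_mat b b"
  shows "trace (kron A B * kron A' B') = trace (A * A') * trace (B * B')"
proof -
  have k: "kron M N $$ (i, j) = M $$ (i div b, j div b) * N $$ (i mod b, j mod b)"
    if "M \<in> carrier_mat a a" "N \<in> carrier_mat b b" "i < a * b" "j < a * b" for M N i j
    using that by (auto simp: kron_def)
  have "trace (kron A B * kron A' B') = (\<Sum>i<a * b. \<Sum>j<a * b.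
      (A $$ (i div b, j div b) * B $$ (i mod b, j mod b)) * (A' $$ (j div b, i div b) * B' $$ (j mod b, i mod b)))"
    unfolding trace_mult_eq[OF kron_carrier[OF A(1) B(1)] kron_carrier[OF A(2) B(2)]]
    by (intro sum.cong refl) (simp add: k A B)
  also have "\<dots> = (\<Sum>i<a. \<Sum>i'<b. \<Sum>j<a. \<Sum>j'<b.
      (A $$ (i, j) * B $$ (i', j')) * (A' $$ (j, i) * B' $$ (j', i')))"
    unfolding sum_div_mod[of "\<lambda>i i'. \<Sum>j<a * b. (A $$ (i, j div b) * B $$ (i', j mod b))
        * (A' $$ (j div b, i) * B' $$ (j mod b, i'))" b a]
    by (rule sum.cong[OF refl], rule sum.cong[OF refl], rule sum_div_mod)
  also have "\<dots> = (\<Sum>i<a. \<Sum>i'<b. (\<Sum>j<a. A $$ (i, j) * A' $$ (j, i)) * (\<Sum>j'<b. B $$ (i', j') * B' $$ (j', i')))"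
    by (simp add: sum_product mult_ac)
  also have "\<dots> = trace (A * A') * trace (B * B')"
    unfolding trace_mult_eq[OF A] trace_mult_eq[OF B] by (simp add: sum_product)
  finally show ?thesis .
qed

lemma tensor_carrier:
  "(\<And>A. A \<in> set As \<Longrightarrow> A \<in> carrier_mat d d) \<Longrightarrow> tensor As \<in> carrier_mat (d ^ length As) (d ^ length As)"
  by (induction As) (auto simp: tensor_def intro!: kron_carrier)

lemma trace_tensor_mult:
  assumes "length As = length Bs" "\<And>A. A \<in> set As \<Longrightarrow> A \<in> carrier_mat d d"
    "\<And>B. B \<in> set Bs \<Longrightarrow> B \<in> carrier_mat d d"
  shows "trace (tensor As * tensor Bs) = (\<Prod>i<length As. trace (As ! i * Bs ! i))"
  using assms
proof (induction As Bs rule: list_induct2)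
  case Nil
  then show ?case by (simp add: tensor_def trace_def)
next
  case (Cons A As B Bs)
  have "tensor As \<in> carrier_mat (d ^ length As) (d ^ length As)"
    "tensor Bs \<in> carrier_mat (d ^ length As) (d ^ length As)"
    using Cons.prems tensor_carrier[of As d] tensor_carrier[of Bs d] Cons.hyps by auto
  then have "trace (tensor (A # As) * tensor (B # Bs)) = trace (A * B) * trace (tensor As * tensor Bs)"
    using Cons.prems trace_kron_mult[of A d B "tensor As" "d ^ length As" "tensor Bs"]
    by (simp add: tensor_def)
  then show ?case using Cons by (simp add: prod.lessThan_Suc_shift del: prod.lessThan_Suc)
qed

section \<open>Rank-one effects and quadratic forms\<close>

definition rank_one :: "nat \<Rightarrow> (nat \<Rightarrow> complex) \<Rightarrow> complex mat" where
  "rank_one d u = mat d d (\<lambda>(i, j). u i * cnj (u j))"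

text \<open>This is <u|A|u>, the Born weight of the effect \<open>rank_one d u\<close>. Vectors are
  functions on all natural numbers, so a vector meant for dimension p is restricted to dimension d
  by the range of summation alone.\<close>

definition qform :: "nat \<Rightarrow> (nat \<Rightarrow> complex) \<Rightarrow> complex mat \<Rightarrow> complex" where
  "qform d u A = (\<Sum>i<d. \<Sum>j<d. cnj (u i) * A $$ (i, j) * u j)"

lemma rank_one_carrier[simp]: "rank_one d u \<in> carrier_mat d d"
  by (simp add: rank_one_def)

lemma rank_one_index: "i < d \<Longrightarrow> j < d \<Longrightarrow> rank_one d u $$ (i, j) = u i * cnj (u j)"
  by (simp add: rank_one_def)

lemma trace_rank_one_mult:
  assumes A: "A \<in> carrier_mat d d"
  shows "trace (rank_one d u * A) = qform d u A"
proof -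
  have "trace (rank_one d u * A) = (\<Sum>i<d. \<Sum>k<d. cnj (u k) * A $$ (k, i) * u i)"
    unfolding trace_mult_eq[OF rank_one_carrier A]
    by (intro sum.cong refl) (simp add: rank_one_index)
  then show ?thesis unfolding qform_def by (subst (asm) sum.swap)
qed

lemma qform_eq_cscalar_prod:
  assumes A: "A \<in> carrier_mat d d"
  shows "qform d u A = (A *\<^sub>v vec d u) \<bullet>c vec d u"
proof -
  have "(A *\<^sub>v vec d u) \<bullet>c vec d u = (\<Sum>i<d. (A *\<^sub>v vec d u) $ i * cnj (vec d u $ i))"
    by (rule cscalar_prod_eq) simp
  also have "\<dots> = (\<Sum>i<d. (\<Sum>j<d. A $$ (i, j) * vec d u $ j) * cnj (vec d u $ i))"
    by (intro sum.cong refl) (subst mult_vec_index[OF A], auto)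
  also have "\<dots> = qform d u A"
    unfolding qform_def by (intro sum.cong refl) (simp add: sum_distrib_right sum_distrib_left mult_ac)
  finally show ?thesis by simp
qed

lemma qform_psd:
  assumes "psd d A"
  shows "0 \<le> Re (qform d u A)" "Im (qform d u A) = 0"
proof -
  have "A \<in> carrier_mat d d" "0 \<le> (A *\<^sub>v vec d u) \<bullet>c vec d u"
    using assms by (auto simp: psd_def)
  then have "0 \<le> qform d u A" by (simp add: qform_eq_cscalar_prod)
  then show "0 \<le> Re (qform d u A)" "Im (qform d u A) = 0" by (auto simp: less_eq_complex_def)
qed

lemma qform_diff:
  assumes "A \<in> carrier_mat d d" "B \<in> carrier_mat d d"
  shows "qform d u (A - B) = qform d u A - qform d u B"
proof -
  have "qform d u (A - B) = (\<Sum>i<d. \<Sum>j<d. cnj (u i) * A $$ (i, j) * u j - cnj (u i) * B $$ (i, j) * u j)"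
    unfolding qform_def using assms by (intro sum.cong refl) (simp add: algebra_simps)
  then show ?thesis by (simp add: qform_def sum_subtractf)
qed

lemma rank_one_psd: "psd d (rank_one d u)"
  unfolding psd_def
proof (intro conjI ballI)
  show "mat_adjoint (rank_one d u) = rank_one d u"
  proof (rule eq_matI)
    fix i j assume "i < dim_row (rank_one d u)" "j < dim_col (rank_one d u)"
    then have ij: "i < d" "j < d" by (auto simp: rank_one_def)
    show "mat_adjoint (rank_one d u) $$ (i, j) = rank_one d u $$ (i, j)"
      unfolding adjoint_index[OF rank_one_carrier ij] using ij by (simp add: rank_one_index)
  qed (use adjoint_carrier[OF rank_one_carrier[of d u]] in \<open>auto simp: rank_one_def\<close>)
  fix v :: "complex vec" assume v: "v \<in> carrier_vec d"
  define z where "z = (\<Sum>j<d. cnj (u j) * v $ j)"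
  have "(rank_one d u *\<^sub>v v) $ i = u i * z" if "i < d" for i
    unfolding mult_vec_index[OF rank_one_carrier v that] z_def sum_distrib_left
    using that by (intro sum.cong refl) (simp add: rank_one_index)
  then have "(rank_one d u *\<^sub>v v) \<bullet>c v = (\<Sum>i<d. u i * z * cnj (v $ i))"
    unfolding cscalar_prod_eq[OF v] by (intro sum.cong) auto
  also have "\<dots> = z * (\<Sum>i<d. u i * cnj (v $ i))"
    by (simp add: sum_distrib_left mult_ac)
  also have "(\<Sum>i<d. u i * cnj (v $ i)) = cnj z" by (simp add: z_def)
  also have "z * cnj z = complex_of_real ((cmod z)\<^sup>2)" by (rule complex_norm_square[symmetric])
  finally show "0 \<le> (rank_one d u *\<^sub>v v) \<bullet>c v" by (simp add: less_eq_complex_def)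
qed simp

definition frame_povm :: "nat \<Rightarrow> nat \<Rightarrow> (nat \<Rightarrow> nat \<Rightarrow> complex) \<Rightarrow> complex mat list" where
  "frame_povm d n u = map (\<lambda>x. rank_one d (u x)) [0..<n]"

lemma foldr_add_mat:
  fixes Es :: "complex mat list"
  assumes "\<And>E. E \<in> set Es \<Longrightarrow> E \<in> carrier_mat d d"
  shows "foldr (+) Es (0\<^sub>m d d) \<in> carrier_mat d d
    \<and> (\<forall>i<d. \<forall>j<d. foldr (+) Es (0\<^sub>m d d) $$ (i, j) = (\<Sum>E\<leftarrow>Es. E $$ (i, j)))"
  using assms by (induction Es) auto

lemma frame_povm:
  assumes "\<And>i j. i < d \<Longrightarrow> j < d \<Longrightarrow> (\<Sum>x<n. u x i * cnj (u x j)) = (if i = j then 1 else 0)"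
  shows "povm d (frame_povm d n u)"
proof -
  have sum: "(\<Sum>E\<leftarrow>frame_povm d n u. E $$ (i, j)) = (\<Sum>x<n. rank_one d (u x) $$ (i, j))" for i j
    by (simp add: frame_povm_def comp_def sum_list_distinct_conv_sum_set lessThan_atLeast0)
  have c: "E \<in> carrier_mat d d" if "E \<in> set (frame_povm d n u)" for E
    using that by (auto simp: frame_povm_def)
  show ?thesis
    unfolding povm_def
  proof (intro conjI ballI)
    show "psd d E" if "E \<in> set (frame_povm d n u)" for E
      using that by (auto simp: frame_povm_def rank_one_psd)
    show "foldr (+) (frame_povm d n u) (0\<^sub>m d d) = 1\<^sub>m d"
      using foldr_add_mat[OF c] assms by (intro eq_matI) (auto simp: sum rank_one_index)
  qed
qed

lemma sum_qform_frame:
  assumes "\<And>i j. i < d \<Longrightarrow> j < d \<Longrightarrow> (\<Sum>x<n. u x i * cnj (u x j)) = (if i = j then 1 else 0)"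
    and A: "A \<in> carrier_mat d d"
  shows "(\<Sum>x<n. qform d (u x) A) = trace A"
proof -
  have "(\<Sum>x<n. qform d (u x) A) = (\<Sum>i<d. \<Sum>j<d. \<Sum>x<n. A $$ (i, j) * (u x j * cnj (u x i)))"
    unfolding qform_def
    by (subst sum.swap, intro sum.cong refl, subst sum.swap) (simp add: mult_ac)
  also have "\<dots> = (\<Sum>i<d. \<Sum>j<d. A $$ (i, j) * (if j = i then 1 else 0))"
    by (intro sum.cong refl) (simp add: assms flip: sum_distrib_left)
  also have "\<dots> = trace A"
    using A by (simp add: trace_def if_distrib cong: if_cong)
  finally show ?thesis .
qed

lemma product_outcomes_replicate:
  "product_outcomes (replicate N M @ replicate N' M) = words (length M) (N + N')"
proof -
  have "set xs \<subseteq> {..<k} \<longleftrightarrow> (\<forall>i<length xs. xs ! i < k)" for xs and k :: nat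
    by (auto simp: subset_iff in_set_conv_nth)
  then show ?thesis
    by (auto simp: product_outcomes_def words_def list_all2_conv_all_nth nth_append)
qed

text \<open>The trace is multiplicative over tensor factors. Each factor is the form of a positive
  semidefinite matrix and hence real, which is why the real part in \<open>born\<close> passes
  through the product.\<close>

lemma born_product:
  assumes \<rho>: "psd d \<rho>" and \<sigma>: "psd d \<sigma>" and xs: "xs \<in> words n (N + N')"
    and M_def: "M = frame_povm d n u"
  shows "born (tensor (replicate N \<rho> @ replicate N' \<sigma>)) (product_effect (replicate N M @ replicate N' M) xs)
    = (\<Prod>i<N + N'. (if i < N then (\<lambda>x. Re (qform d (u x) \<rho>)) else (\<lambda>x. Re (qform d (u x) \<sigma>))) (xs ! i))"
proof -
  define Es where "Es = map2 (!) (replicate N M @ replicate N' M) xs"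
  define Rs where "Rs = replicate N \<rho> @ replicate N' \<sigma>"
  have len: "length Es = N + N'" "length Rs = N + N'"
    using xs by (auto simp: Es_def Rs_def words_def)
  have Es_nth: "Es ! i = rank_one d (u (xs ! i))" if "i < N + N'" for i
    using that xs words_nth_less[OF xs that]
    by (simp add: Es_def words_def M_def frame_povm_def nth_append)
  have "Es ! i \<in> carrier_mat d d" if "i < N + N'" for i using Es_nth[OF that] by simp
  then have Es_c: "E \<in> carrier_mat d d" if "E \<in> set Es" for E
    using that len by (auto simp: in_set_conv_nth)
  have Rs_c: "R \<in> carrier_mat d d" if "R \<in> set Rs" for R
    using that \<rho> \<sigma> by (auto simp: Rs_def psd_def)
  have "trace (tensor Es * tensor Rs) = (\<Prod>i<N + N'. trace (Es ! i * Rs ! i))"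
    using trace_tensor_mult[of Es Rs d] len Es_c Rs_c by simp
  also have "\<dots> = (\<Prod>i<N + N'. complex_of_real
      ((if i < N then (\<lambda>x. Re (qform d (u x) \<rho>)) else (\<lambda>x. Re (qform d (u x) \<sigma>))) (xs ! i)))"
  proof (intro prod.cong refl)
    fix i assume "i \<in> {..<N + N'}"
    then have i: "i < N + N'" by simp
    have R: "Rs ! i = (if i < N then \<rho> else \<sigma>)" using i by (simp add: Rs_def nth_append)
    have "trace (Es ! i * Rs ! i) = qform d (u (xs ! i)) (Rs ! i)"
      unfolding Es_nth[OF i] by (rule trace_rank_one_mult) (use i len Rs_c in auto)
    then show "trace (Es ! i * Rs ! i) = complex_of_real
      ((if i < N then (\<lambda>x. Re (qform d (u x) \<rho>)) else (\<lambda>x. Re (qform d (u x) \<sigma>))) (xs ! i))"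
      using R qform_psd[OF \<rho>] qform_psd[OF \<sigma>] by (auto simp: complex_eq_iff)
  qed
  finally have tr: "trace (tensor Es * tensor Rs) = (\<Prod>i<N + N'. complex_of_real
      ((if i < N then (\<lambda>x. Re (qform d (u x) \<rho>)) else (\<lambda>x. Re (qform d (u x) \<sigma>))) (xs ! i)))" .
  show ?thesis
    unfolding born_def product_effect_def Es_def[symmetric] Rs_def[symmetric] tr
      of_real_prod[symmetric] Re_complex_of_real ..
qed

section \<open>The parabola measurement\<close>

definition unit_root :: "nat \<Rightarrow> int \<Rightarrow> complex" where
  "unit_root p t = cis (2 * pi * real_of_int t / real p)"

lemma unit_root_add: "unit_root p (s + t) = unit_root p s * unit_root p t"
  by (simp add: unit_root_def cis_mult add_divide_distrib distrib_left)

lemma unit_root_cnj: "cnj (unit_root p t) = unit_root p (- t)"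
  by (simp add: unit_root_def cis_cnj)

lemma unit_root_diff: "unit_root p s * cnj (unit_root p t) = unit_root p (s - t)"
  using unit_root_add[of p s "- t"] by (simp add: unit_root_cnj)

lemma unit_root_power: "unit_root p t ^ k = unit_root p (int k * t)"
  by (simp add: unit_root_def DeMoivre mult_ac)

lemma unit_root_eq_1_iff:
  assumes "p > 0"
  shows "unit_root p t = 1 \<longleftrightarrow> int p dvd t"
proof
  assume "unit_root p t = 1"
  then have "cos (2 * pi * real_of_int t / real p) = 1"
    by (simp add: unit_root_def complex_eq_iff)
  then obtain n :: int where "2 * pi * real_of_int t / real p = of_int n * 2 * pi"
    by (auto simp: cos_one_2pi_int)
  then have "real_of_int t = real_of_int (n * int p)"
    using assms by (simp add: field_simps)
  then have "t = n * int p" by (simp only: of_int_eq_iff)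
  then show "int p dvd t" by simp
next
  assume "int p dvd t"
  then obtain n where n: "t = int p * n" by (auto elim: dvdE)
  have "2 * pi * real_of_int t / real p = 2 * pi * real_of_int n"
    using assms by (simp add: n)
  then show "unit_root p t = 1" by (simp add: unit_root_def cis_multiple_2pi)
qed

lemma sum_unit_root:
  assumes "p > 0"
  shows "(\<Sum>a<p. unit_root p (int a * t)) = (if int p dvd t then of_nat p else 0)"
proof (cases "int p dvd t")
  case True
  then have "unit_root p (int a * t) = 1" for a
    using assms by (simp add: unit_root_eq_1_iff)
  then show ?thesis using True by simp
next
  case False
  define z where "z = unit_root p t"
  have "z \<noteq> 1" using False assms by (simp add: z_def unit_root_eq_1_iff)
  moreover have "z ^ p = 1"
    using assms by (simp add: z_def unit_root_power unit_root_eq_1_iff)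
  ultimately have "(\<Sum>a<p. z ^ a) = 0" by (simp add: geometric_sum)
  then show ?thesis using False by (simp add: z_def unit_root_power)
qed

lemma sum_unit_root_pair:
  assumes "p > 0"
  shows "(\<Sum>a<p. \<Sum>b<p. unit_root p (int a * s + int b * t))
    = (if int p dvd s \<and> int p dvd t then of_nat (p * p) else 0)"
  by (simp add: unit_root_add sum_unit_root[OF assms] flip: sum_product)

text \<open>The points \<open>(i\<^sup>2, i)\<close> form a Sidon set in \<open>(\<int>/p)\<^sup>2\<close>.\<close>

lemma parabola_sidon:
  fixes i j k l p :: nat
  assumes p: "prime p" "2 < p" and lt: "i < p" "j < p" "k < p" "l < p"
  shows "int p dvd (int j * int j - int i * int i) - (int l * int l - int k * int k)
      \<and> int p dvd (int j - int i) - (int l - int k)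
    \<longleftrightarrow> i = j \<and> k = l \<or> i = k \<and> j = l"
proof -
  have small: "x = y" if "int p dvd int x - int y" "x < p" "y < p" for x y
  proof -
    have "\<bar>int x - int y\<bar> < int p" using that by linarith
    then have "int x - int y = 0" using dvd_imp_le_int[OF _ that(1)] by (metis abs_of_nat not_le)
    then show ?thesis by simp
  qed
  have pint: "prime (int p)" using p by simp
  show ?thesis
  proof
    assume *: "int p dvd (int j * int j - int i * int i) - (int l * int l - int k * int k)
      \<and> int p dvd (int j - int i) - (int l - int k)"
    define t where "t = (int j - int i) - (int l - int k)"
    have t: "int p dvd t" using * by (simp add: t_def)
    show "i = j \<and> k = l \<or> i = k \<and> j = l"
    proof (cases "i = j")
      case True
      then have "int p dvd int k - int l" using t by (simp add: t_def)
      then show ?thesis using True small lt by blast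
    next
      case False
      \<comment> \<open>Modulo p the differences agree, so the difference of squares acquires the
        factor j - i, which can be cancelled. Then j + i and l + k agree as well, and adding the two
        congruences gives 2 j = 2 l modulo p; here p must be odd.\<close>
      have "(int j * int j - int i * int i) - (int l * int l - int k * int k)
          = (int j - int i) * ((int j + int i) - (int l + int k)) + t * (int l + int k)"
        by (simp add: t_def algebra_simps)
      then have "int p dvd (int j - int i) * ((int j + int i) - (int l + int k))"
        using * t by (metis dvd_add_left_iff dvd_mult2)
      moreover have "\<not> int p dvd int j - int i" using False small lt by metis
      ultimately have "int p dvd (int j + int i) - (int l + int k)"
        using pint by (simp add: prime_dvd_mult_iff)
      then have "int p dvd ((int j + int i) - (int l + int k)) + t" using t by (rule dvd_add)
      also have "((int j + int i) - (int l + int k)) + t = 2 * (int j - int l)"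
        by (simp add: t_def)
      finally have "int p dvd 2 * (int j - int l)" .
      moreover have "\<not> int p dvd 2" using p by (auto dest: zdvd_imp_le)
      ultimately have "int p dvd int j - int l" using pint by (metis prime_dvd_mult_iff)
      then have jl: "j = l" using small lt by blast
      then have "int p dvd int k - int i" using t by (simp add: t_def)
      then show ?thesis using jl small lt by blast
    qed
  qed auto
qed

section \<open>Parseval's identity for the parabola vectors\<close>

definition parabola_vec :: "nat \<Rightarrow> nat \<Rightarrow> nat \<Rightarrow> nat \<Rightarrow> complex" where
  "parabola_vec p a b i = unit_root p (int a * (int i * int i) + int b * int i)"

lemma parabola_vec_mult_cnj:
  "parabola_vec p a b i * cnj (parabola_vec p a b j)
    = unit_root p (int a * (int i * int i - int j * int j) + int b * (int i - int j))"
  by (simp add: parabola_vec_def unit_root_cnj algebra_simps flip: unit_root_add)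

lemma sum_parabola_vec:
  assumes p: "prime p" "2 < p" and ij: "i < p" "j < p"
  shows "(\<Sum>a<p. \<Sum>b<p. parabola_vec p a b i * cnj (parabola_vec p a b j))
    = (if i = j then of_nat (p * p) else 0)"
proof -
  \<comment> \<open>The Sidon property is applied with the trivial difference of i with itself as
    the second pair.\<close>
  have "int p dvd (int i * int i - int j * int j) \<and> int p dvd (int i - int j) \<longleftrightarrow> i = j"
    using parabola_sidon[OF p ij(2,1) ij(1,1)] ij by auto
  then show ?thesis
    unfolding parabola_vec_mult_cnj using p by (subst sum_unit_root_pair) auto
qed

text \<open>As a function of (a, b) the form is a trigonometric polynomial whose frequencies are
  differences of parabola points. Each off-diagonal entry has a frequency of its own, whereas all
  diagonal entries share frequency 0 and enter only through their sum.\<close>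

lemma sum_qform_parabola_vec:
  assumes p: "prime p" "2 < p" and d: "d \<le> p"
  shows "(\<Sum>a<p. \<Sum>b<p. (cmod (qform d (parabola_vec p a b) A))\<^sup>2)
    = real (p * p) * ((cmod (\<Sum>i<d. A $$ (i, i)))\<^sup>2 + (\<Sum>i<d. \<Sum>j<d. of_bool (i \<noteq> j) * (cmod (A $$ (i, j)))\<^sup>2))"
proof -
  define Q where "Q = {..<d} \<times> {..<d}"
  define c where "c x = A $$ x" for x
  define s where "s x y = (int (snd x) * int (snd x) - int (fst x) * int (fst x))
      - (int (snd y) * int (snd y) - int (fst y) * int (fst y))" for x y :: "nat \<times> nat"
  define t where "t x y = (int (snd x) - int (fst x)) - (int (snd y) - int (fst y))" for x y :: "nat \<times> nat"
  have q: "qform d (parabola_vec p a b) A = (\<Sum>x\<in>Q. c x * unit_root p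
      (int a * (int (snd x) * int (snd x) - int (fst x) * int (fst x)) + int b * (int (snd x) - int (fst x))))" for a b
    unfolding qform_def Q_def sum.cartesian_product c_def
    by (intro sum.cong refl)
      (auto simp flip: parabola_vec_mult_cnj simp: mult_ac)
  have "complex_of_real ((cmod (qform d (parabola_vec p a b) A))\<^sup>2)
      = (\<Sum>x\<in>Q. \<Sum>y\<in>Q. c x * cnj (c y) * unit_root p (int a * s x y + int b * t x y))" for a b
  proof -
    have "complex_of_real ((cmod (qform d (parabola_vec p a b) A))\<^sup>2)
        = qform d (parabola_vec p a b) A * cnj (qform d (parabola_vec p a b) A)"
      by (rule complex_norm_square)
    also have "\<dots> = (\<Sum>x\<in>Q. \<Sum>y\<in>Q. c x * cnj (c y) * unit_root p (int a * s x y + int b * t x y))"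
      unfolding q cnj_sum sum_product
    proof (intro sum.cong refl)
      fix x y :: "nat \<times> nat"
      define u where "u x = int a * (int (snd x) * int (snd x) - int (fst x) * int (fst x))
        + int b * (int (snd x) - int (fst x))" for x :: "nat \<times> nat"
      have "u x - u y = int a * s x y + int b * t x y"
        by (simp add: u_def s_def t_def algebra_simps)
      then have "unit_root p (int a * s x y + int b * t x y) = unit_root p (u x) * cnj (unit_root p (u y))"
        by (simp only: unit_root_diff)
      then show "c x * unit_root p (int a * (int (snd x) * int (snd x) - int (fst x) * int (fst x))
            + int b * (int (snd x) - int (fst x)))
          * cnj (c y * unit_root p (int a * (int (snd y) * int (snd y) - int (fst y) * int (fst y))
            + int b * (int (snd y) - int (fst y))))
        = c x * cnj (c y) * unit_root p (int a * s x y + int b * t x y)"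
        unfolding u_def[symmetric] by (simp only: complex_cnj_mult mult_ac)
    qed
    finally show ?thesis .
  qed
  then have "complex_of_real (\<Sum>a<p. \<Sum>b<p. (cmod (qform d (parabola_vec p a b) A))\<^sup>2)
      = (\<Sum>a<p. \<Sum>b<p. \<Sum>x\<in>Q. \<Sum>y\<in>Q. c x * cnj (c y) * unit_root p (int a * s x y + int b * t x y))"
    by (simp only: of_real_sum)
  also have "\<dots> = (\<Sum>x\<in>Q. \<Sum>y\<in>Q. c x * cnj (c y) * (\<Sum>a<p. \<Sum>b<p. unit_root p (int a * s x y + int b * t x y)))"
  proof -
    have swap: "(\<Sum>a<p. \<Sum>b<p. \<Sum>z\<in>R. f a b z) = (\<Sum>z\<in>R. \<Sum>a<p. \<Sum>b<p. f a b z)"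
      for f :: "nat \<Rightarrow> nat \<Rightarrow> nat \<times> nat \<Rightarrow> complex" and R
      by (rule trans[OF sum.cong[OF refl sum.swap] sum.swap])
    show ?thesis unfolding swap sum_distrib_left ..
  qed
  \<comment> \<open>The second indicator excludes the diagonal, so that the pairs with
    \<open>x = y\<close> on it are not counted twice.\<close>
  also have "\<dots> = (\<Sum>x\<in>Q. \<Sum>y\<in>Q. of_nat (p * p) * (c x * cnj (c y)
      * (of_bool (fst x = snd x) * of_bool (fst y = snd y) + of_bool (fst x \<noteq> snd x \<and> x = y))))"
  proof (intro sum.cong refl)
    fix x y assume "x \<in> Q" "y \<in> Q"
    then have lt: "fst x < p" "snd x < p" "fst y < p" "snd y < p" using d by (auto simp: Q_def)
    have "(\<Sum>a<p. \<Sum>b<p. unit_root p (int a * s x y + int b * t x y))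
        = (if fst x = snd x \<and> fst y = snd y \<or> fst x = fst y \<and> snd x = snd y then of_nat (p * p) else 0)"
      unfolding parabola_sidon[OF p lt, symmetric] s_def t_def
      using p by (intro sum_unit_root_pair) simp
    then show "c x * cnj (c y) * (\<Sum>a<p. \<Sum>b<p. unit_root p (int a * s x y + int b * t x y))
      = of_nat (p * p) * (c x * cnj (c y)
      * (of_bool (fst x = snd x) * of_bool (fst y = snd y) + of_bool (fst x \<noteq> snd x \<and> x = y)))"
      by (auto simp: prod_eq_iff)
  qed
  also have "\<dots> = of_nat (p * p) * ((\<Sum>x\<in>Q. c x * of_bool (fst x = snd x)) * cnj (\<Sum>x\<in>Q. c x * of_bool (fst x = snd x))
      + (\<Sum>x\<in>Q. of_bool (fst x \<noteq> snd x) * (c x * cnj (c x))))"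
  proof -
    have fin: "finite Q" by (simp add: Q_def)
    have "(\<Sum>y\<in>Q. c x * cnj (c y) * of_bool (fst x \<noteq> snd x \<and> x = y))
        = of_bool (fst x \<noteq> snd x) * (c x * cnj (c x))" if "x \<in> Q" for x
    proof -
      have "(\<Sum>y\<in>Q. c x * cnj (c y) * of_bool (fst x \<noteq> snd x \<and> x = y))
          = (\<Sum>y\<in>Q. if y = x then of_bool (fst x \<noteq> snd x) * (c x * cnj (c x)) else 0)"
        by (intro sum.cong) auto
      then show ?thesis using that fin by simp
    qed
    moreover have "(\<Sum>x\<in>Q. \<Sum>y\<in>Q. c x * cnj (c y) * (of_bool (fst x = snd x) * of_bool (fst y = snd y)))
        = (\<Sum>x\<in>Q. c x * of_bool (fst x = snd x)) * cnj (\<Sum>x\<in>Q. c x * of_bool (fst x = snd x))"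
      unfolding cnj_sum sum_product by (intro sum.cong refl) auto
    ultimately show ?thesis
      by (simp only: sum_distrib_left[symmetric] distrib_left sum.distrib cong: sum.cong)
  qed
  also have "(\<Sum>x\<in>Q. c x * of_bool (fst x = snd x)) = (\<Sum>i<d. A $$ (i, i))"
    unfolding Q_def c_def by (simp add: sum.cartesian_product' of_bool_def if_distrib cong: if_cong)
  also have "(\<Sum>x\<in>Q. of_bool (fst x \<noteq> snd x) * (c x * cnj (c x)))
      = complex_of_real (\<Sum>i<d. \<Sum>j<d. of_bool (i \<noteq> j) * (cmod (A $$ (i, j)))\<^sup>2)"
    unfolding Q_def c_def sum.cartesian_product of_real_sum
    by (intro sum.cong refl) (simp add: case_prod_unfold complex_norm_square del: of_real_power)
  also have "(\<Sum>i<d. A $$ (i, i)) * cnj (\<Sum>i<d. A $$ (i, i)) = complex_of_real ((cmod (\<Sum>i<d. A $$ (i, i)))\<^sup>2)"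
    by (rule complex_norm_square[symmetric])
  finally show ?thesis
    by (metis (no_types, lifting) of_real_add of_real_eq_iff of_real_mult of_real_of_nat_eq)
qed


text \<open>The small weight \<open>1 / p\<close> of the standard basis keeps the collision probability at \<open>O(1 / p\<^sup>2)\<close>
  even for diagonal states.\<close>

definition test_vec :: "nat \<Rightarrow> nat \<Rightarrow> nat \<Rightarrow> complex" where
  "test_vec p x i =
     (if x < p * p then complex_of_real (sqrt (1 - 1 / real p) / real p) * parabola_vec p (x div p) (x mod p) i
      else if i = x - p * p then complex_of_real (1 / sqrt (real p)) else 0)"

lemma sum_lessThan_add:
  fixes f :: "nat \<Rightarrow> 'a :: comm_monoid_add"
  shows "(\<Sum>x<m + n. f x) = (\<Sum>x<m. f x) + (\<Sum>x<n. f (m + x))"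
  by (induction n) (simp_all add: add.assoc)

text \<open>The parabola vectors resolve 1 - 1 / p times the identity and the basis vectors the
  remaining 1 / p.\<close>

lemma sum_test_vec_frame:
  assumes p: "prime p" "2 < p" and d: "d \<le> p" and ij: "i < d" "j < d"
  shows "(\<Sum>x<p * p + d. test_vec p x i * cnj (test_vec p x j)) = (if i = j then 1 else 0)"
proof -
  define w where "w = complex_of_real (sqrt (1 - 1 / real p) / real p)"
  define g where "g a b = w * cnj w * (parabola_vec p a b i * cnj (parabola_vec p a b j))" for a b
  have w: "w * cnj w * of_nat (p * p) = complex_of_real (1 - 1 / real p)"
  proof -
    have "(sqrt (1 - 1 / real p) / real p) * (sqrt (1 - 1 / real p) / real p) * real (p * p) = 1 - 1 / real p"
      using p by (simp add: real_sqrt_mult_self)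
    from arg_cong[OF this, of complex_of_real] show ?thesis
      by (simp only: w_def complex_cnj_complex_of_real of_real_mult of_real_of_nat_eq)
  qed
  have "(\<Sum>x<p * p. test_vec p x i * cnj (test_vec p x j)) = (\<Sum>x<p * p. g (x div p) (x mod p))"
    by (intro sum.cong refl) (simp add: test_vec_def g_def w_def mult_ac)
  also have "\<dots> = (\<Sum>a<p. \<Sum>b<p. g a b)" by (rule sum_div_mod)
  also have "\<dots> = w * cnj w * (if i = j then of_nat (p * p) else 0)"
    unfolding g_def using sum_parabola_vec[OF p, of i j] ij d by (simp flip: sum_distrib_left)
  finally have 1: "(\<Sum>x<p * p. test_vec p x i * cnj (test_vec p x j))
      = (if i = j then complex_of_real (1 - 1 / real p) else 0)"
    using w by simp
  have "(\<Sum>x<d. test_vec p (p * p + x) i * cnj (test_vec p (p * p + x) j))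
      = (\<Sum>x<d. if x = i then (if i = j then complex_of_real (1 / real p) else 0) else 0)"
    using p by (intro sum.cong refl) (auto simp: test_vec_def simp flip: of_real_mult)
  then have 2: "(\<Sum>x<d. test_vec p (p * p + x) i * cnj (test_vec p (p * p + x) j))
      = (if i = j then complex_of_real (1 / real p) else 0)"
    using ij by simp
  show ?thesis unfolding sum_lessThan_add 1 2 by (simp flip: of_real_add)
qed

text \<open>Both families act on the scale 1 / p^2, which explains the weights: w^4 times the
  Parseval factor p^2 is (1 - 1 / p)^2 / p^2, and v^4 is 1 / p^2. Multiplication by p^2 clears this
  common scale.\<close>

lemma sum_qform_test_vec:
  assumes p: "prime p" "2 < p" and d: "d \<le> p"
  shows "(\<Sum>x<p * p + d. (cmod (qform d (test_vec p x) A))\<^sup>2) * (real p)\<^sup>2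
    = (1 - 1 / real p)\<^sup>2 * ((cmod (\<Sum>i<d. A $$ (i, i)))\<^sup>2
        + (\<Sum>i<d. \<Sum>j<d. of_bool (i \<noteq> j) * (cmod (A $$ (i, j)))\<^sup>2))
      + (\<Sum>i<d. (cmod (A $$ (i, i)))\<^sup>2)"
proof -
  define w where "w = sqrt (1 - 1 / real p) / real p"
  define v where "v = 1 / sqrt (real p)"
  have ww: "w * w = (1 - 1 / real p) / (real p)\<^sup>2" and vv: "v * v = 1 / real p"
    using p by (simp_all add: w_def v_def real_sqrt_mult_self power2_eq_square)
  have "qform d (test_vec p x) A = complex_of_real (w * w) * qform d (parabola_vec p (x div p) (x mod p)) A"
    if "x < p * p" for x
    unfolding qform_def sum_distrib_left
    by (intro sum.cong refl) (use that in \<open>simp add: test_vec_def flip: w_def\<close>)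
  then have "(\<Sum>x<p * p. (cmod (qform d (test_vec p x) A))\<^sup>2)
      = (\<Sum>x<p * p. (w * w)\<^sup>2 * (cmod (qform d (parabola_vec p (x div p) (x mod p)) A))\<^sup>2)"
    by (intro sum.cong refl) (simp add: norm_mult power_mult_distrib)
  also have "\<dots> = (\<Sum>a<p. \<Sum>b<p. (w * w)\<^sup>2 * (cmod (qform d (parabola_vec p a b) A))\<^sup>2)"
    by (rule sum_div_mod)
  also have "\<dots> = (w * w)\<^sup>2 * (real (p * p) * ((cmod (\<Sum>i<d. A $$ (i, i)))\<^sup>2
      + (\<Sum>i<d. \<Sum>j<d. of_bool (i \<noteq> j) * (cmod (A $$ (i, j)))\<^sup>2)))"
    unfolding sum_qform_parabola_vec[OF p d, symmetric] by (simp only: sum_distrib_left)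
  also have "(w * w)\<^sup>2 * (real (p * p) * s) = (1 - 1 / real p)\<^sup>2 * s / (real p)\<^sup>2" for s
    using p by (simp add: ww power2_eq_square)
  finally have 1: "(\<Sum>x<p * p. (cmod (qform d (test_vec p x) A))\<^sup>2)
      = (1 - 1 / real p)\<^sup>2 * ((cmod (\<Sum>i<d. A $$ (i, i)))\<^sup>2
      + (\<Sum>i<d. \<Sum>j<d. of_bool (i \<noteq> j) * (cmod (A $$ (i, j)))\<^sup>2)) / (real p)\<^sup>2" .
  have "qform d (test_vec p (p * p + x)) A = complex_of_real (v * v) * A $$ (x, x)" if x: "x < d" for x
  proof -
    have tv: "test_vec p (p * p + x) i = (if i = x then complex_of_real v else 0)" for i
      by (simp add: test_vec_def v_def)
    have "qform d (test_vec p (p * p + x)) A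
        = (\<Sum>i<d. if i = x then (\<Sum>j<d. if j = x then complex_of_real (v * v) * A $$ (x, x) else 0) else 0)"
      unfolding qform_def
    proof (rule sum.cong[OF refl])
      fix i
      show "(\<Sum>j<d. cnj (test_vec p (p * p + x) i) * A $$ (i, j) * test_vec p (p * p + x) j)
        = (if i = x then (\<Sum>j<d. if j = x then complex_of_real (v * v) * A $$ (x, x) else 0) else 0)"
      proof (cases "i = x")
        case True
        then show ?thesis by (simp only: if_True simp_thms) (intro sum.cong refl, simp add: tv)
      next
        case False
        then show ?thesis by (simp add: tv)
      qed
    qed
    then show ?thesis using x by simp
  qed
  then have "(\<Sum>x<d. (cmod (qform d (test_vec p (p * p + x)) A))\<^sup>2) = (\<Sum>x<d. (1 / real p)\<^sup>2 * (cmod (A $$ (x, x)))\<^sup>2)"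
    unfolding vv by (intro sum.cong refl) (simp add: norm_mult norm_divide power_mult_distrib power_divide)
  then have 2: "(\<Sum>x<d. (cmod (qform d (test_vec p (p * p + x)) A))\<^sup>2) = (\<Sum>x<d. (cmod (A $$ (x, x)))\<^sup>2) / (real p)\<^sup>2"
    by (simp add: sum_divide_distrib power_divide)
  show ?thesis unfolding sum_lessThan_add 1 2 using p by (simp add: distrib_right)
qed

lemma frobenius_sq_split:
  "frobenius_sq d A = (\<Sum>i<d. (cmod (A $$ (i, i)))\<^sup>2) + (\<Sum>i<d. \<Sum>j<d. of_bool (i \<noteq> j) * (cmod (A $$ (i, j)))\<^sup>2)"
proof -
  have "(\<Sum>j<d. (cmod (A $$ (i, j)))\<^sup>2) = (cmod (A $$ (i, i)))\<^sup>2 + (\<Sum>j<d. of_bool (i \<noteq> j) * (cmod (A $$ (i, j)))\<^sup>2)"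
    if "i < d" for i
  proof -
    have "(\<Sum>j<d. (cmod (A $$ (i, j)))\<^sup>2)
        = (\<Sum>j<d. (if j = i then (cmod (A $$ (i, i)))\<^sup>2 else 0) + of_bool (i \<noteq> j) * (cmod (A $$ (i, j)))\<^sup>2)"
      by (intro sum.cong) auto
    then show ?thesis using that by (simp add: sum.distrib)
  qed
  then show ?thesis unfolding frobenius_sq_def by (simp add: sum.distrib)
qed

text \<open>The basis vectors supply the diagonal entries and the parabola vectors the others; the
  trace term is nonnegative. The 4 comes from 1 - 1 / p \<ge> 1 / 2.\<close>

lemma sum_qform_test_vec_ge:
  assumes p: "prime p" "2 < p" and d: "d \<le> p"
  shows "frobenius_sq d A / (4 * (real p)\<^sup>2) \<le> (\<Sum>x<p * p + d. (cmod (qform d (test_vec p x) A))\<^sup>2)"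
proof -
  define T where "T = (cmod (\<Sum>i<d. A $$ (i, i)))\<^sup>2"
  define R where "R = (\<Sum>i<d. \<Sum>j<d. of_bool (i \<noteq> j) * (cmod (A $$ (i, j)))\<^sup>2)"
  define G where "G = (\<Sum>i<d. (cmod (A $$ (i, i)))\<^sup>2)"
  have nn: "0 \<le> T" "0 \<le> R" "0 \<le> G" by (auto simp: T_def R_def G_def intro!: sum_nonneg)
  have "(1 / 2)\<^sup>2 \<le> (1 - 1 / real p)\<^sup>2"
    using p by (intro power_mono) (auto simp: field_simps)
  then have "1 / 4 \<le> (1 - 1 / real p)\<^sup>2" by (simp add: power2_eq_square)
  then have "1 / 4 * (T + R) \<le> (1 - 1 / real p)\<^sup>2 * (T + R)" using nn by (intro mult_right_mono) auto
  then have "1 / 4 * frobenius_sq d A \<le> (\<Sum>x<p * p + d. (cmod (qform d (test_vec p x) A))\<^sup>2) * (real p)\<^sup>2"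
    unfolding sum_qform_test_vec[OF p d] frobenius_sq_split T_def[symmetric] R_def[symmetric] G_def[symmetric]
    using nn by simp
  then show ?thesis using p by (simp add: field_simps)
qed

text \<open>For a state the trace term is 1 and the squared entries sum to at most 1; together they
  give the 2.\<close>

lemma sum_qform_test_vec_le:
  assumes p: "prime p" "2 < p" and d: "d \<le> p" and \<rho>: "\<rho> \<in> density_operators d"
  shows "(\<Sum>x<p * p + d. (cmod (qform d (test_vec p x) \<rho>))\<^sup>2) \<le> 2 * (1 / real p)\<^sup>2"
proof -
  define R where "R = (\<Sum>i<d. \<Sum>j<d. of_bool (i \<noteq> j) * (cmod (\<rho> $$ (i, j)))\<^sup>2)"
  define G where "G = (\<Sum>i<d. (cmod (\<rho> $$ (i, i)))\<^sup>2)"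
  have nn: "0 \<le> R" "0 \<le> G" by (auto simp: R_def G_def intro!: sum_nonneg)
  have "\<rho> \<in> carrier_mat d d" "trace \<rho> = 1" using \<rho> by (auto simp: density_operators_def psd_def)
  then have tr: "(\<Sum>i<d. \<rho> $$ (i, i)) = 1" by (simp add: trace_eq)
  have fro: "G + R \<le> 1"
    using frobenius_sq_density_le[OF \<rho>] unfolding frobenius_sq_split R_def G_def .
  have "(1 - 1 / real p)\<^sup>2 \<le> 1" using p by (intro power_le_one) (auto simp: field_simps)
  then have "(1 - 1 / real p)\<^sup>2 * (1 + R) \<le> 1 * (1 + R)" using nn by (intro mult_right_mono) auto
  then have "(\<Sum>x<p * p + d. (cmod (qform d (test_vec p x) \<rho>))\<^sup>2) * (real p)\<^sup>2 \<le> 2"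
    unfolding sum_qform_test_vec[OF p d] R_def[symmetric] G_def[symmetric] tr using fro by simp
  then show ?thesis using p by (simp add: field_simps)
qed

section \<open>Assembling the tester\<close>

lemma verdict_prob_words:
  assumes \<rho>: "psd d \<rho>" and \<sigma>: "psd d \<sigma>" and M: "M = frame_povm d n u"
  shows "verdict_prob (replicate N M) (replicate N' M) f \<rho> \<sigma> b
    = (\<Sum>xs | xs \<in> words n (N + N') \<and> f xs = b.
        \<Prod>i<N + N'. (if i < N then (\<lambda>x. Re (qform d (u x) \<rho>)) else (\<lambda>x. Re (qform d (u x) \<sigma>))) (xs ! i))"
proof -
  have "length M = n" by (simp add: M frame_povm_def)
  then show ?thesis
    unfolding verdict_prob_def product_outcomes_replicate length_replicate
    by (intro sum.cong refl) (use born_product[OF \<rho> \<sigma> _ M] in auto)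
qed

theorem theorem1p2p5:
  shows "\<exists>K::real. \<forall>(d::nat) (\<epsilon>::real). 1 \<le> d \<longrightarrow> 0 < \<epsilon> \<longrightarrow> \<epsilon> \<le> 1 \<longrightarrow>
    (\<exists>Ms Ns f.
       (\<forall>M\<in>set Ms. povm d M) \<and> (\<forall>N\<in>set Ns. povm d N) \<and>
       real (length Ms) \<le> K * (real d)\<^sup>2 / \<epsilon>\<^sup>2 \<and>
       real (length Ns) \<le> K * (real d)\<^sup>2 / \<epsilon>\<^sup>2 \<and>
       (\<forall>\<rho>\<in>density_operators d. \<forall>\<sigma>\<in>density_operators d.
          (\<rho> = \<sigma> \<longrightarrow> verdict_prob Ms Ns f \<rho> \<sigma> Yes \<ge> 2 / 3) \<and>
          (trace_norm (\<rho> - \<sigma>) > \<epsilon> \<longrightarrow> verdict_prob Ms Ns f \<rho> \<sigma> No \<ge> 2 / 3)))"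
proof -
  obtain C :: real where C: "C > 0"
    and ex_prime: "\<And>d::nat. d \<ge> 1 \<Longrightarrow> \<exists>p::nat. prime p \<and> 2 < p \<and> d \<le> p \<and> real p \<le> C * real d"
    using ex_prime_linear by blast
  show ?thesis
  proof (intro exI[of _ "1536 * C + 2"] allI impI)
    fix d :: nat and \<epsilon> :: real
    assume d: "1 \<le> d" and \<epsilon>: "0 < \<epsilon>" "\<epsilon> \<le> 1"
    obtain p :: nat where p: "prime p" "2 < p" and dp: "d \<le> p" and pC: "real p \<le> C * real d"
      using ex_prime[OF d] by blast
    define n where "n = p * p + d"
    define u where "u = test_vec p"
    define M where "M = frame_povm d n u"
    define \<eta> where "\<eta> = \<epsilon>\<^sup>2 / (4 * real d * (real p)\<^sup>2)"
    \<comment> \<open>Chosen so that m \<eta> \<ge> 192 / p, the requirement of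
      \<open>l2_test\<close> for r = 1 / p; 768 is 192 times the 4 in the denominator of
      \<eta>.\<close>
    define m where "m = nat \<lceil>768 * real d * real p / \<epsilon>\<^sup>2\<rceil>"
    define f where "f xs = (if l2_statistic n m xs < real m ^ 2 * \<eta> / 2 then Yes else No)" for xs
    have f_iff: "f xs = No \<longleftrightarrow> \<not> l2_statistic n m xs < real m ^ 2 * \<eta> / 2"
      "f xs = Yes \<longleftrightarrow> l2_statistic n m xs < real m ^ 2 * \<eta> / 2" for xs
      by (auto simp: f_def)
    have \<eta>: "0 < \<eta>" using \<epsilon> d p by (simp add: \<eta>_def)
    have big: "0 < 768 * real d * real p / \<epsilon>\<^sup>2" using \<epsilon> d p by simp
    then have m0: "0 < m" unfolding m_def by linarith
    have m_ge: "768 * real d * real p / \<epsilon>\<^sup>2 \<le> real m" unfolding m_def by linarith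
    have m_le: "real m \<le> 768 * real d * real p / \<epsilon>\<^sup>2 + 1" unfolding m_def using big by linarith
    have m\<eta>: "192 * (1 / real p) \<le> real m * \<eta>"
    proof -
      have "192 * (1 / real p) = 768 * real d * real p / \<epsilon>\<^sup>2 * \<eta>"
        using \<epsilon> d p by (simp add: \<eta>_def field_simps power2_eq_square)
      also have "\<dots> \<le> real m * \<eta>" using m_ge \<eta> by (intro mult_right_mono) auto
      finally show ?thesis .
    qed
    have frame: "(\<Sum>x<n. u x i * cnj (u x j)) = (if i = j then 1 else 0)" if "i < d" "j < d" for i j
      unfolding n_def u_def by (rule sum_test_vec_frame[OF p dp that])
    have povm: "povm d M" unfolding M_def by (rule frame_povm[OF frame])
    \<comment> \<open>Each state is measured 2 m times. Inserting p \<le> C d gives 2 * 768 * C, and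
      the 1 lost in rounding up is absorbed by d^2 / eps^2 \<ge> 1, which adds 2.\<close>
    have size: "real (2 * m) \<le> (1536 * C + 2) * (real d)\<^sup>2 / \<epsilon>\<^sup>2"
    proof -
      have "real d * real p \<le> real d * (C * real d)" using pC by (intro mult_left_mono) auto
      then have "768 * (real d * real p) \<le> 768 * C * (real d)\<^sup>2"
        by (simp add: power2_eq_square mult_ac)
      then have "768 * (real d * real p) / \<epsilon>\<^sup>2 \<le> 768 * C * (real d)\<^sup>2 / \<epsilon>\<^sup>2"
        by (rule divide_right_mono) simp
      moreover have "1 \<le> (real d)\<^sup>2 / \<epsilon>\<^sup>2"
        using \<epsilon> d power_mono[of \<epsilon> "real d" 2] by simp
      ultimately show ?thesis using m_le by (simp add: add_divide_distrib distrib_right)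
    qed
    show "\<exists>Ms Ns f.
       (\<forall>M\<in>set Ms. povm d M) \<and> (\<forall>N\<in>set Ns. povm d N) \<and>
       real (length Ms) \<le> (1536 * C + 2) * (real d)\<^sup>2 / \<epsilon>\<^sup>2 \<and>
       real (length Ns) \<le> (1536 * C + 2) * (real d)\<^sup>2 / \<epsilon>\<^sup>2 \<and>
       (\<forall>\<rho>\<in>density_operators d. \<forall>\<sigma>\<in>density_operators d.
          (\<rho> = \<sigma> \<longrightarrow> verdict_prob Ms Ns f \<rho> \<sigma> Yes \<ge> 2 / 3) \<and>
          (trace_norm (\<rho> - \<sigma>) > \<epsilon> \<longrightarrow> verdict_prob Ms Ns f \<rho> \<sigma> No \<ge> 2 / 3))"
    proof (intro exI[of _ "replicate (2 * m) M"] exI[of _ f] conjI ballI)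
      fix \<rho> \<sigma> assume \<rho>: "\<rho> \<in> density_operators d" and \<sigma>: "\<sigma> \<in> density_operators d"
      have psd: "psd d \<rho>" "psd d \<sigma>" and tr: "trace \<rho> = 1" "trace \<sigma> = 1"
        using \<rho> \<sigma> by (auto simp: density_operators_def)
      note car = psd_carrier[OF psd(1)] psd_carrier[OF psd(2)]
      define P where "P x = Re (qform d (u x) \<rho>)" for x
      define Q where "Q x = Re (qform d (u x) \<sigma>)" for x
      have "(\<Sum>x<n. P x) = Re (trace \<rho>)" "(\<Sum>x<n. Q x) = Re (trace \<sigma>)"
        unfolding P_def Q_def by (simp_all add: sum_qform_frame[OF frame] car flip: Re_sum)
      then interpret two_samples n m P Q
        by unfold_locales (auto simp: P_def Q_def qform_psd psd tr)
      have P_sq: "(P x)\<^sup>2 = (cmod (qform d (u x) \<rho>))\<^sup>2" "(Q x)\<^sup>2 = (cmod (qform d (u x) \<sigma>))\<^sup>2" for x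
        by (simp_all add: P_def Q_def cmod_power2 qform_psd psd)
      have r: "(\<Sum>x<n. (P x)\<^sup>2) \<le> 2 * (1 / real p)\<^sup>2" "(\<Sum>x<n. (Q x)\<^sup>2) \<le> 2 * (1 / real p)\<^sup>2"
        unfolding P_sq n_def u_def by (rule sum_qform_test_vec_le[OF p dp \<rho>], rule sum_qform_test_vec_le[OF p dp \<sigma>])
      have r0: "0 \<le> 1 / real p" by simp
      note test = l2_test[OF r0 r \<eta> m\<eta> m0]
      have prob: "verdict_prob (replicate (2 * m) M) (replicate (2 * m) M) f \<rho> \<sigma> b
          = (\<Sum>xs | xs \<in> words n (4 * m) \<and> f xs = b. weight xs)" for b
      proof -
        have "2 * m + 2 * m = 4 * m" by simp
        then show ?thesis
          unfolding verdict_prob_words[OF psd M_def] weight_def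
          unfolding P_def[abs_def] Q_def[abs_def] by (simp only:)
      qed
      \<comment> \<open>Chebyshev bounds the probability of the wrong verdict by 1 / 3; that the two
        verdicts have total probability 1 turns this into success with probability at least 2 /
        3.\<close>
      have total: "verdict_prob (replicate (2 * m) M) (replicate (2 * m) M) f \<rho> \<sigma> Yes
          + verdict_prob (replicate (2 * m) M) (replicate (2 * m) M) f \<rho> \<sigma> No = 1"
      proof -
        have "(\<Sum>xs\<in>{xs \<in> words n (4 * m). f xs = Yes} \<union> {xs \<in> words n (4 * m). f xs = No}. weight xs)
            = (\<Sum>xs | xs \<in> words n (4 * m) \<and> f xs = Yes. weight xs) + (\<Sum>xs | xs \<in> words n (4 * m) \<and> f xs = No. weight xs)"
          by (rule sum.union_disjoint) (auto simp: finite_words)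
        also have "{xs \<in> words n (4 * m). f xs = Yes} \<union> {xs \<in> words n (4 * m). f xs = No} = words n (4 * m)"
          using verdict.exhaust by auto
        finally have "(\<Sum>xs\<in>words n (4 * m). weight xs)
            = (\<Sum>xs | xs \<in> words n (4 * m) \<and> f xs = Yes. weight xs) + (\<Sum>xs | xs \<in> words n (4 * m) \<and> f xs = No. weight xs)" .
        then show ?thesis using expect_one by (simp add: prob expect_def)
      qed
      show "\<rho> = \<sigma> \<longrightarrow> 2 / 3 \<le> verdict_prob (replicate (2 * m) M) (replicate (2 * m) M) f \<rho> \<sigma> Yes"
      proof
        assume eq: "\<rho> = \<sigma>"
        have "verdict_prob (replicate (2 * m) M) (replicate (2 * m) M) f \<rho> \<sigma> No \<le> 1 / 3"
          unfolding prob f_iff by (rule test(1)) (simp add: P_def Q_def eq)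
        then show "2 / 3 \<le> verdict_prob (replicate (2 * m) M) (replicate (2 * m) M) f \<rho> \<sigma> Yes"
          using total by linarith
      qed
      show "\<epsilon> < trace_norm (\<rho> - \<sigma>) \<longrightarrow> 2 / 3 \<le> verdict_prob (replicate (2 * m) M) (replicate (2 * m) M) f \<rho> \<sigma> No"
      proof
        assume far: "\<epsilon> < trace_norm (\<rho> - \<sigma>)"
        have "\<epsilon>\<^sup>2 \<le> (trace_norm (\<rho> - \<sigma>))\<^sup>2" using far \<epsilon> by (intro power_mono) auto
        also have "\<dots> \<le> real d * frobenius_sq d (\<rho> - \<sigma>)"
          by (rule trace_norm_sq_le) (rule minus_carrier_mat[OF car(2)])
        finally have "\<epsilon>\<^sup>2 / (4 * real d * (real p)\<^sup>2) \<le> real d * frobenius_sq d (\<rho> - \<sigma>) / (4 * real d * (real p)\<^sup>2)"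
          by (rule divide_right_mono) simp
        then have "\<eta> \<le> frobenius_sq d (\<rho> - \<sigma>) / (4 * (real p)\<^sup>2)"
          using d by (simp add: \<eta>_def)
        also have "\<dots> \<le> (\<Sum>x<n. (cmod (qform d (u x) (\<rho> - \<sigma>)))\<^sup>2)"
          unfolding n_def u_def by (rule sum_qform_test_vec_ge[OF p dp])
        also have "\<dots> = dist_sq"
          unfolding dist_sq_def qform_diff[OF car]
          by (simp add: cmod_power2 P_def Q_def qform_psd psd)
        finally have "verdict_prob (replicate (2 * m) M) (replicate (2 * m) M) f \<rho> \<sigma> Yes \<le> 1 / 3"
          unfolding prob f_iff by (rule test(2))
        then show "2 / 3 \<le> verdict_prob (replicate (2 * m) M) (replicate (2 * m) M) f \<rho> \<sigma> No"
          using total by linarith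
      qed
    qed (use povm size in auto)
  qed
qed

end
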